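(* Let $J$ be a forward kernel on $E=\mathbb{R}\times X$, let $\eta\in[0,\infty)$, and let $Q:\mathbb{R}\times\mathbb{R}\to[0,\infty)$ be super-additive, i.e. $Q(u,r)+Q(r,v)\le Q(u,v)$ for all $u<r<v$. Let $dt=\mu(dt)$ be a $\sigma$-finite, non-atomic (nonnegative) measure on $(\mathbb{R},\mathcal{B}_{\mathbb{R}})$, and let $k(s,x,t,A)\ge0$, defined for $s,t\in\mathbb{R}$, $x\in X$, $A\in\mathcal{M}$, be such that $A\mapsto k(s,x,t,A)$ is a measure, $k(s,x,t,dy)\,dt$ is a forward kernel on $E$, and $(s,x)\mapsto k(s,x,t,A)$ is jointly measurable for all $t\in\mathbb{R}$ and $A\in\mathcal{M}$. Let $k_0=k$ and, for $n=1,2,\ldots$, $$k_n(s,x,t,A)=\int_s^t\int_X k_{n-1}(s,x,u,dz)\int_{(u,t)\times X}J(u,z,du_1dz_1)\,k(u_1,z_1,t,A)\,du,$$ and let $\widetilde k=\sum_{n=0}^\infty k_n$. Assume that for all $s,t\in\mathbb{R}$, $x\in X$, $A\in\mathcal{M}$, $$\int_s^t\int_X k(s,x,u,dz)\int_{(u,t)\times X}J(u,z,du_1dz_1)\,k(u_1,z_1,t,A)\,du\le[\eta+Q(s,t)]\,k(s,x,t,A).$$ Then for all $n=1,2,\ldots$, $(s,x)\in E$ and $t\in\mathbb{R}$, $$k_n(s,x,t,dy)\le k_{n-1}(s,x,t,dy)\left[\eta+\frac{Q(s,t)}{n}\right]\le k(s,x,t,dy)\prod_{l=1}^n\left[\eta+\frac{Q(s,t)}{l}\right].$$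 If $0<\eta<1$, then for all $(s,x)\in E$ and $t\in\mathbb{R}$, $$\widetilde k(s,x,t,dy)\le k(s,x,t,dy)\left(\frac{1}{1-\eta}\right)^{1+Q(s,t)/\eta}.$$ If $\eta=0$, then for all $(s,x)\in E$ and $t\in\mathbb{R}$, $$\widetilde k(s,x,t,dy)\le k(s,x,t,dy)\,e^{Q(s,t)}.$$
   Context: $(X,\mathcal{M})$ is a measurable space, $\mathbb{R}$ carries its Borel $\sigma$-algebra $\mathcal{B}_{\mathbb{R}}$, and $E=\mathbb{R}\times X$ carries the product $\sigma$-algebra $\mathcal{E}=\mathcal{B}_{\mathbb{R}}\times\mathcal{M}$. A kernel on $E$ is a map $K:E\times\mathcal{E}\to[0,\infty]$ such that $(s,x)\mapsto K(s,x,A)$ is $\mathcal{E}$-measurable for every $A\in\mathcal{E}$ and $A\mapsto K(s,x,A)$ is countably additive (a measure) for every $(s,x)\in E$. A kernel $K$ on $E$ is forward if for all $s\in\mathbb{R}$, $x\in X$, $A\in\mathcal{E}$: $K(s,x,A)=0$ whenever $A\subseteq(-\infty,s]\times X$. The symbols $dt,du$ denote integration with respect to the fixed measure $\mu$; $\int_s^t$ is the integral over $\{u: s<u<t\}$ (zero if $t\le s$). Inequalities such as $k_n(s,x,t,dy)\le c\,k(s,x,t,dy)$ are inequalities between measures on $(X,\mathcal{M})$.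
   Formalization: Additionally assumed: J is an s-finite kernel (a countable sum of finite kernels), and (s,x,t) ↦ k(s,x,t,·) is an s-finite kernel, in particular jointly measurable in (s,x,t). For arbitrary [0,∞]-valued kernels the stated bounds can fail, since Tonelli's theorem fails. *)

theory Defs
  imports "HOL-Analysis.Analysis"
begin

abbreviation spacetime :: "'a measure \<Rightarrow> (real \<times> 'a) measure" where
  "spacetime M \<equiv> borel \<Otimes>\<^sub>M M"

definition kernel :: "'a measure \<Rightarrow> 'b measure \<Rightarrow> ('a \<Rightarrow> 'b measure) \<Rightarrow> bool" where
  "kernel N M K \<longleftrightarrow>
     (\<forall>a\<in>space N. sets (K a) = sets M) \<and>
     (\<forall>A\<in>sets M. (\<lambda>a. emeasure (K a) A) \<in> borel_measurable N)"

definition forward_kernel :: "'a measure \<Rightarrow> (real \<times> 'a \<Rightarrow> (real \<times> 'a) measure) \<Rightarrow> bool" where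
  "forward_kernel M K \<longleftrightarrow>
     kernel (spacetime M) (spacetime M) K \<and>
     (\<forall>s. \<forall>x\<in>space M. \<forall>A\<in>sets (spacetime M).
        A \<subseteq> {..s} \<times> space M \<longrightarrow> emeasure (K (s, x)) A = 0)"

text \<open>A finite kernel need not be uniformly bounded here; cutting it up along the level sets of its
  total mass shows that this describes the same class of s-finite kernels.\<close>

definition finite_kernel :: "'a measure \<Rightarrow> 'b measure \<Rightarrow> ('a \<Rightarrow> 'b measure) \<Rightarrow> bool" where
  "finite_kernel N M K \<longleftrightarrow> kernel N M K \<and> (\<forall>a\<in>space N. finite_measure (K a))"

definition s_finite_kernel :: "'a measure \<Rightarrow> 'b measure \<Rightarrow> ('a \<Rightarrow> 'b measure) \<Rightarrow> bool" where
  "s_finite_kernel N M K \<longleftrightarrow>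
     kernel N M K \<and>
     (\<exists>L :: nat \<Rightarrow> 'a \<Rightarrow> 'b measure. (\<forall>i. finite_kernel N M (L i)) \<and>
        (\<forall>a\<in>space N. \<forall>A\<in>sets M. emeasure (K a) A = (\<Sum>i. emeasure (L i a) A)))"

definition non_atomic :: "'a measure \<Rightarrow> bool" where
  "non_atomic m \<longleftrightarrow>
     (\<forall>A\<in>sets m. 0 < emeasure m A \<longrightarrow>
        (\<exists>B\<in>sets m. B \<subseteq> A \<and> 0 < emeasure m B \<and> emeasure m B < emeasure m A))"

text \<open>The kernel \<open>k(s,x,t,dy) dt\<close>, that is \<open>A \<mapsto> \<integral> k(s,x,t,A\<^sub>t) dt\<close> where \<open>A\<^sub>t\<close> is the section
  of \<open>A\<close> at \<open>t\<close>. For this to be meaningful the integrand has to be measurable in \<open>t\<close>, which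
  is part of \<open>forward_density\<close>; the set function is then countably additive, so that \<open>measure_of\<close>
  does not fall back to the null measure.\<close>

definition density_kernel ::
  "'a measure \<Rightarrow> real measure \<Rightarrow> (real \<Rightarrow> 'a \<Rightarrow> real \<Rightarrow> 'a measure) \<Rightarrow> real \<times> 'a \<Rightarrow> (real \<times> 'a) measure"
  where
  "density_kernel M \<mu> k = (\<lambda>(s, x).
     measure_of (space (spacetime M)) (sets (spacetime M))
       (\<lambda>A. \<integral>\<^sup>+t. emeasure (k s x t) (Pair t -` A) \<partial>\<mu>))"

definition forward_density ::
  "'a measure \<Rightarrow> real measure \<Rightarrow> (real \<Rightarrow> 'a \<Rightarrow> real \<Rightarrow> 'a measure) \<Rightarrow> bool" where
  "forward_density M \<mu> k \<longleftrightarrow>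
     (\<forall>s. \<forall>x\<in>space M. \<forall>A\<in>sets (spacetime M).
        (\<lambda>t. emeasure (k s x t) (Pair t -` A)) \<in> borel_measurable \<mu>) \<and>
     forward_kernel M (density_kernel M \<mu> k)"

definition super_additive :: "(real \<Rightarrow> real \<Rightarrow> real) \<Rightarrow> bool" where
  "super_additive Q \<longleftrightarrow> (\<forall>u r v. u < r \<longrightarrow> r < v \<longrightarrow> Q u r + Q r v \<le> Q u v)"

definition perturb ::
  "'a measure \<Rightarrow> real measure \<Rightarrow> (real \<times> 'a \<Rightarrow> (real \<times> 'a) measure) \<Rightarrow>
   (real \<Rightarrow> 'a \<Rightarrow> real \<Rightarrow> 'a measure) \<Rightarrow> (real \<Rightarrow> 'a \<Rightarrow> real \<Rightarrow> 'a measure) \<Rightarrow>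
   real \<Rightarrow> 'a \<Rightarrow> real \<Rightarrow> 'a set \<Rightarrow> ennreal" where
  "perturb M \<mu> J k l s x t A =
     (\<integral>\<^sup>+u\<in>{s<..<t}. (\<integral>\<^sup>+z.
        (\<integral>\<^sup>+p\<in>{u<..<t} \<times> space M. emeasure (k (fst p) (snd p) t) A \<partial>J (u, z))
      \<partial>l s x u) \<partial>\<mu>)"

text \<open>The \<open>k\<^sub>n\<close> are set functions; \<open>measure_of\<close> only turns \<open>k\<^sub>n(s,x,u,\<cdot>)\<close> into an object one can
  integrate against. That they are measures is part of what \<open>measure_le\<close> asserts below.\<close>

primrec series_term ::
  "'a measure \<Rightarrow> real measure \<Rightarrow> (real \<times> 'a \<Rightarrow> (real \<times> 'a) measure) \<Rightarrow>
   (real \<Rightarrow> 'a \<Rightarrow> real \<Rightarrow> 'a measure) \<Rightarrow> nat \<Rightarrow> real \<Rightarrow> 'a \<Rightarrow> real \<Rightarrow> 'a set \<Rightarrow> ennreal" where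
  "series_term M \<mu> J k 0 = (\<lambda>s x t A. emeasure (k s x t) A)"
| "series_term M \<mu> J k (Suc n) =
     perturb M \<mu> J k (\<lambda>s x u. measure_of (space M) (sets M) (series_term M \<mu> J k n s x u))"

definition series_sum ::
  "'a measure \<Rightarrow> real measure \<Rightarrow> (real \<times> 'a \<Rightarrow> (real \<times> 'a) measure) \<Rightarrow>
   (real \<Rightarrow> 'a \<Rightarrow> real \<Rightarrow> 'a measure) \<Rightarrow> real \<Rightarrow> 'a \<Rightarrow> real \<Rightarrow> 'a set \<Rightarrow> ennreal" where
  "series_sum M \<mu> J k s x t A = (\<Sum>n. series_term M \<mu> J k n s x t A)"

definition measure_le :: "'a measure \<Rightarrow> ('a set \<Rightarrow> ennreal) \<Rightarrow> ('a set \<Rightarrow> ennreal) \<Rightarrow> bool" where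
  "measure_le M f g \<longleftrightarrow>
     measure_space (space M) (sets M) f \<and> measure_space (space M) (sets M) g \<and>
     (\<forall>A\<in>sets M. f A \<le> g A)"

text \<open>The iterated integrals defining \<open>k\<^sub>n\<close> can be reordered (Tonelli) only if the kernels are s-finite
  and \<open>k\<close> is measurable jointly in \<open>(s,x,t)\<close>. For general kernels
  \<open>\<integral> k\<^sub>1(s,x,u,dz) f(u,z) du\<close> may differ from the integral of \<open>f\<close> against the composition
  of \<open>k dt\<close>, \<open>J\<close> and \<open>k dt\<close>, and the bounds on \<open>k\<^sub>2\<close> and on the whole series then fail:
  let \<open>X\<close> be a point, \<open>dt\<close> the Lebesgue measure and \<open>I\<^sub>j = (j-1,j)\<close>. Let \<open>J(u,\<cdot>)\<close> be counting measure on
  \<open>I\<^sub>2\<close> for \<open>u\<close> in \<open>I\<^sub>1\<close>, Lebesgue measure on \<open>I\<^sub>4\<close> for \<open>u\<close> in \<open>I\<^sub>3\<close>, and \<open>0\<close> otherwise. Let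
  \<open>k(s,t) = 1\<close> for \<open>s < t\<close> in \<open>I\<^sub>1\<close>, for \<open>(s,t)\<close> in \<open>I\<^sub>1 \<times> I\<^sub>3\<close>, \<open>I\<^sub>1 \<times> I\<^sub>5\<close> or \<open>I\<^sub>4 \<times> I\<^sub>5\<close>, and for
  \<open>s\<close> in \<open>I\<^sub>2\<close> with \<open>t = s + 1\<close>; let \<open>k = 0\<close> otherwise. With \<open>\<eta> = 0\<close> and \<open>Q(u,v) = 1\<close> if
  \<open>u < 1\<close> and \<open>v \<ge> 2\<close>, \<open>Q(u,v) = 0\<close> otherwise, one gets \<open>k\<^sub>1 \<le> Q k\<close>, but for \<open>s\<close> in \<open>I\<^sub>1\<close> and
  \<open>t\<close> in \<open>I\<^sub>5\<close> one has \<open>k(s,t) = k\<^sub>1(s,t) = 1\<close> and \<open>k\<^sub>2(s,t) = 1 - s\<close>, so neither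
  \<open>k\<^sub>2 \<le> k\<^sub>1 Q/2\<close> nor (for small \<open>s\<close>) the exponential bound holds.\<close>

definition tonelli_regular ::
  "'a measure \<Rightarrow> (real \<times> 'a \<Rightarrow> (real \<times> 'a) measure) \<Rightarrow> (real \<Rightarrow> 'a \<Rightarrow> real \<Rightarrow> 'a measure) \<Rightarrow> bool" where
  "tonelli_regular M J k \<longleftrightarrow>
     s_finite_kernel (spacetime M) (spacetime M) J \<and>
     s_finite_kernel (spacetime M \<Otimes>\<^sub>M borel) M (\<lambda>((s, x), t). k s x t)"

end

theory Submission
  imports Defs
begin

text \<open>Super-additivity enters through a double count. Associativity gives
  \<open>k\<^sub>n\<^sub>+\<^sub>1 = k\<^sub>n J k = k\<^sub>n\<^sub>-\<^sub>1 J k\<^sub>1\<close>. Bounding \<open>k\<^sub>n\<close> by the induction hypothesis in the first form and \<open>k\<^sub>1\<close> by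
  the assumption in the second inserts the factor \<open>\<eta> + Q(s,u)/n\<close>, respectively \<open>\<eta> + Q(u\<^sub>1,t)\<close>, into the
  iterated integral \<open>k\<^sub>n = k\<^sub>n\<^sub>-\<^sub>1 J k\<close>, where \<open>J\<close> jumps from time \<open>u\<close> to time \<open>u\<^sub>1\<close>. Taking \<open>n\<close> times the first plus the second and using
  \<open>Q(s,u) + Q(u\<^sub>1,t) \<le> Q(s,t)\<close> yields \<open>(n + 1) k\<^sub>n\<^sub>+\<^sub>1 \<le> ((n + 1) \<eta> + Q(s,t)) k\<^sub>n\<close>. The resulting products are
  the terms of a binomial series (of the exponential series if \<open>\<eta> = 0\<close>).\<close>

subsection \<open>S-finite kernels\<close>

text \<open>Associativity amounts to moving the integral over the second time past three others,
  while the measures \<open>J (u, z)\<close> and \<open>k s x t\<close> need not be sigma-finite.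
  Sigma-finiteness would not survive the recursion anyway: already the image of a sigma-finite
  measure can fail to be sigma-finite. S-finiteness is stable under composition of kernels, so it is
  carried from each term to the next, and it suffices for an exchange with \<mu>, the only kind that
  occurs. The weight n is dictated by n (\<eta> + Q(s,u)/n) = n \<eta> + Q(s,u): now Q(s,u) and
  Q(u_1,t) appear with the same coefficient. To add the two estimates, both must be integrals of one
  common function of u with measurable factors. Therefore Q(u_1,t) is first replaced by its bound
  Q(s,t) - Q(s,u), which depends on u alone and comes out of the integrals over k_n and J.\<close>

lemma nn_integral_suminf_measure:
  fixes L :: "nat \<Rightarrow> 'a measure"
  assumes [measurable_cong]: "\<And>i. sets (L i) = sets K"
    and em: "\<And>A. A \<in> sets K \<Longrightarrow> emeasure K A = (\<Sum>i. emeasure (L i) A)"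
    and f: "f \<in> borel_measurable K"
  shows "(\<integral>\<^sup>+x. f x \<partial>K) = (\<Sum>i. \<integral>\<^sup>+x. f x \<partial>L i)"
  using f
proof (induct rule: borel_measurable_induct)
  case (cong f g)
  have "\<And>i. space (L i) = space K"
    using assms(1) by (rule sets_eq_imp_space_eq)
  then have "(\<integral>\<^sup>+x. f x \<partial>K) = (\<integral>\<^sup>+x. g x \<partial>K)" "\<And>i. (\<integral>\<^sup>+x. f x \<partial>L i) = (\<integral>\<^sup>+x. g x \<partial>L i)"
    using cong(3) by (auto intro!: nn_integral_cong)
  then show ?case using cong(4) by simp
next
  case (set A)
  then show ?case by (simp add: assms(1) em)
next
  case (mult u c)
  then show ?case by (simp add: nn_integral_cmult)
next
  case (add u v)
  have [measurable]: "u \<in> borel_measurable K" "v \<in> borel_measurable K" by fact+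
  show ?case using add by (simp add: nn_integral_add suminf_add[symmetric])
next
  case (seq U)
  have [measurable]: "\<And>i. U i \<in> borel_measurable K" by fact
  have U: "\<And>N. (\<integral>\<^sup>+x. Sup (range U) x \<partial>N) = (\<integral>\<^sup>+x. (SUP i. U i x) \<partial>N)"
    by (simp add: image_comp)
  have "(\<Sum>j. SUP i. \<integral>\<^sup>+x. U i x \<partial>L j) = (SUP i. \<Sum>j. \<integral>\<^sup>+x. U i x \<partial>L j)"
    by (rule ennreal_suminf_SUP_eq) (auto simp: incseq_def le_fun_def intro!: nn_integral_mono
        dest: incseqD[OF \<open>incseq U\<close>])
  then show ?case
    unfolding U using seq by (simp add: nn_integral_monotone_convergence_SUP)
qed

section \<open>Measurability of sections and of kernel integrals\<close>

text \<open>Finiteness is what the Dynkin argument consumes: the section of a complement is measured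
  by a difference, which is of no use when both terms are infinite. The s-finite case is reached
  afterwards by summing over finite pieces.\<close>

lemma finite_kernel_measurable_emeasure_Pair:
  assumes K: "finite_kernel N M K" and Q: "Q \<in> sets (N \<Otimes>\<^sub>M M)"
  shows "(\<lambda>a. emeasure (K a) (Pair a -` Q)) \<in> borel_measurable N" (is "?s Q \<in> _")
proof -
  have sets: "\<And>a. a \<in> space N \<Longrightarrow> sets (K a) = sets M"
    and [measurable]: "\<And>A. A \<in> sets M \<Longrightarrow> (\<lambda>a. emeasure (K a) A) \<in> borel_measurable N"
    and fin: "\<And>a. a \<in> space N \<Longrightarrow> finite_measure (K a)"
    using K by (auto simp: finite_kernel_def kernel_def)
  have space: "\<And>a. a \<in> space N \<Longrightarrow> space (K a) = space M"
    using sets by (rule sets_eq_imp_space_eq)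
  show ?thesis
    using Int_stable_pair_measure_generator pair_measure_closed Q
    unfolding sets_pair_measure
  proof (induct rule: sigma_sets_induct_disjoint)
    case (basic A)
    then obtain B C where A: "A = B \<times> C" and [measurable]: "B \<in> sets N" "C \<in> sets M" by auto
    have "?s A a = emeasure (K a) C * indicator B a" for a
      by (auto simp: A indicator_def)
    then show ?case by simp
  next
    case empty
    then show ?case by simp
  next
    case (compl A)
    then have A: "A \<in> sets (N \<Otimes>\<^sub>M M)" by (simp add: sets_pair_measure)
    have "?s (space N \<times> space M - A) a = emeasure (K a) (space M) - ?s A a" if a: "a \<in> space N" for a
    proof -
      interpret finite_measure "K a" using a by (rule fin)
      have "Pair a -` (space N \<times> space M - A) = space (K a) - Pair a -` A"
        using a by (auto simp: space)
      moreover have "emeasure (K a) (space (K a) - Pair a -` A) = emeasure (K a) (space (K a)) - ?s A a"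
        using A a by (intro emeasure_compl) (simp_all add: sets sets_Pair1)
      ultimately show ?thesis using a by (simp add: space)
    qed
    then show ?case using compl(2) by (simp cong: measurable_cong)
  next
    case (union F)
    then have F: "\<And>i. F i \<in> sets (N \<Otimes>\<^sub>M M)" by (simp add: sets_pair_measure subset_eq)
    have "?s (\<Union>i. F i) a = (\<Sum>i. ?s (F i) a)" if a: "a \<in> space N" for a
      using F a union(1)
      by (simp add: suminf_emeasure disjoint_family_on_vimageI subset_eq vimage_UN sets sets_Pair1)
    then show ?case using union(3) by (simp cong: measurable_cong)
  qed
qed

lemma s_finite_kernel_measurable_emeasure_Pair:
  assumes K: "s_finite_kernel N M K" and Q: "Q \<in> sets (N \<Otimes>\<^sub>M M)"
  shows "(\<lambda>a. emeasure (K a) (Pair a -` Q)) \<in> borel_measurable N"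
proof -
  obtain L :: "nat \<Rightarrow> _" where "\<And>i. finite_kernel N M (L i)"
    and L: "\<And>a A. a \<in> space N \<Longrightarrow> A \<in> sets M \<Longrightarrow> emeasure (K a) A = (\<Sum>i. emeasure (L i a) A)"
    using K unfolding s_finite_kernel_def by blast
  then have [measurable]: "\<And>i. (\<lambda>a. emeasure (L i a) (Pair a -` Q)) \<in> borel_measurable N"
    using Q by (intro finite_kernel_measurable_emeasure_Pair)
  show ?thesis
    using Q by (subst measurable_cong[OF L]) (auto intro: sets_Pair1)
qed

lemma s_finite_kernel_sets: "s_finite_kernel N M K \<Longrightarrow> a \<in> space N \<Longrightarrow> sets (K a) = sets M"
  by (simp add: s_finite_kernel_def kernel_def)

lemma s_finite_kernel_space: "s_finite_kernel N M K \<Longrightarrow> a \<in> space N \<Longrightarrow> space (K a) = space M"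
  by (intro sets_eq_imp_space_eq s_finite_kernel_sets)

lemma s_finite_kernel_measurable_emeasure:
  "s_finite_kernel N M K \<Longrightarrow> A \<in> sets M \<Longrightarrow> (\<lambda>a. emeasure (K a) A) \<in> borel_measurable N"
  by (simp add: s_finite_kernel_def kernel_def)

lemma s_finite_kernel_measurable_nn_integral:
  assumes K: "s_finite_kernel N M K" and f: "f \<in> borel_measurable (N \<Otimes>\<^sub>M M)"
  shows "(\<lambda>a. \<integral>\<^sup>+b. f (a, b) \<partial>K a) \<in> borel_measurable N"
  using f
proof (induct rule: borel_measurable_induct)
  case (cong f g)
  then have "(\<integral>\<^sup>+b. f (a, b) \<partial>K a) = (\<integral>\<^sup>+b. g (a, b) \<partial>K a)" if "a \<in> space N" for a
    using that by (auto simp: space_pair_measure s_finite_kernel_space[OF K] intro!: nn_integral_cong)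
  then show ?case using cong(4) by (simp cong: measurable_cong)
next
  case (set A)
  have "(\<integral>\<^sup>+b. indicator A (a, b) \<partial>K a) = emeasure (K a) (Pair a -` A)" if "a \<in> space N" for a
  proof -
    have [simp]: "indicator A (a, b) = indicator (Pair a -` A) b" for b
      by (auto simp: indicator_def)
    show ?thesis using set that by (simp add: sets_Pair1 s_finite_kernel_sets[OF K])
  qed
  then show ?case
    using s_finite_kernel_measurable_emeasure_Pair[OF K set] by (simp cong: measurable_cong)
next
  case (mult u c)
  then have "(\<integral>\<^sup>+b. c * u (a, b) \<partial>K a) = c * (\<integral>\<^sup>+b. u (a, b) \<partial>K a)" if "a \<in> space N" for a
    using that by (intro nn_integral_cmult)
      (simp add: measurable_cong_sets[OF s_finite_kernel_sets[OF K that] refl] measurable_Pair2)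
  then show ?case using mult(4) by (simp cong: measurable_cong)
next
  case (add u v)
  then have "(\<integral>\<^sup>+b. v (a, b) + u (a, b) \<partial>K a) = (\<integral>\<^sup>+b. v (a, b) \<partial>K a) + (\<integral>\<^sup>+b. u (a, b) \<partial>K a)"
    if "a \<in> space N" for a
    using that by (intro nn_integral_add)
      (simp_all add: measurable_cong_sets[OF s_finite_kernel_sets[OF K that] refl] measurable_Pair2)
  then show ?case using add by (simp cong: measurable_cong)
next
  case (seq U)
  have "(\<integral>\<^sup>+b. (SUP i. U i (a, b)) \<partial>K a) = (SUP i. \<integral>\<^sup>+b. U i (a, b) \<partial>K a)" if "a \<in> space N" for a
    using that seq(1,4) by (intro nn_integral_monotone_convergence_SUP)
      (auto simp: measurable_cong_sets[OF s_finite_kernel_sets[OF K that] refl] measurable_Pair2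
        incseq_def le_fun_def)
  moreover have "(\<integral>\<^sup>+b. Sup (range U) (a, b) \<partial>K a) = (\<integral>\<^sup>+b. (SUP i. U i (a, b)) \<partial>K a)" for a
    by (simp add: image_comp)
  ultimately show ?case using seq(3) by (simp cong: measurable_cong)
qed

section \<open>Decomposition into pieces of mass at most 1\<close>

text \<open>Piece j takes the share of \<open>K a\<close> that corresponds to the part of the
  interval [0, m(a)] inside [j, j+1], so its mass is the length of that part. The share depends on
  \<open>a\<close> only through the total mass, hence measurably, and is constant in the target
  variable.\<close>

lemma finite_kernel_bounded_decomposition:
  assumes K: "finite_kernel N M K"
  obtains L :: "nat \<Rightarrow> 'a \<Rightarrow> 'b measure"
  where "\<And>i. kernel N M (L i)"
    and "\<And>i a. a \<in> space N \<Longrightarrow> emeasure (L i a) (space M) \<le> 1"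
    and "\<And>a A. a \<in> space N \<Longrightarrow> A \<in> sets M \<Longrightarrow> emeasure (K a) A = (\<Sum>i. emeasure (L i a) A)"
proof -
  have sets: "\<And>a. a \<in> space N \<Longrightarrow> sets (K a) = sets M"
    and [measurable]: "\<And>A. A \<in> sets M \<Longrightarrow> (\<lambda>a. emeasure (K a) A) \<in> borel_measurable N"
    and fin: "\<And>a. a \<in> space N \<Longrightarrow> finite_measure (K a)"
    using K by (auto simp: finite_kernel_def kernel_def)
  have space: "\<And>a. a \<in> space N \<Longrightarrow> space (K a) = space M"
    using sets by (rule sets_eq_imp_space_eq)
  define m where "m a = measure (K a) (space M)" for a
  have em: "emeasure (K a) (space M) = ennreal (m a)" if "a \<in> space N" for a
    unfolding m_def using finite_measure.emeasure_eq_measure[OF fin[OF that]] by simp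
  have [measurable]: "m \<in> borel_measurable N"
    unfolding m_def measure_def by measurable
  have m_nonneg: "0 \<le> m a" for a by (simp add: m_def)
  \<comment> \<open>The numerators telescope to r, so for r > 0 the shares sum to 1.\<close>
  define w where "w j r = (min r (real (Suc j)) - min r (real j)) / r" for j and r :: real
  have [measurable]: "w j \<in> borel_measurable borel" for j
    unfolding w_def by measurable
  have w_nonneg: "0 \<le> w j r" if "0 \<le> r" for j r
    using that by (auto simp: w_def intro!: divide_nonneg_nonneg)
  have w_bound: "w j r * r \<le> 1" if "0 \<le> r" for j r
    using that by (cases "r = 0") (auto simp: w_def)
  have w_sums: "(\<lambda>j. w j r) sums 1" if "0 < r" for r
  proof -
    have "eventually (\<lambda>j. r = min r (real j)) sequentially"
      using eventually_ge_at_top[of "nat \<lceil>r\<rceil>"] by eventually_elim linarith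
    then have "(\<lambda>j. min r (real j)) \<longlonglongrightarrow> r"
      by (rule Lim_transform_eventually[OF tendsto_const])
    from sums_divide[OF telescope_sums[OF this], of r] show ?thesis
      using that by (simp add: w_def)
  qed
  define L where "L j a = density (K a) (\<lambda>_. ennreal (w j (m a)))" for j a
  have L: "emeasure (L j a) A = ennreal (w j (m a)) * emeasure (K a) A"
    if "a \<in> space N" "A \<in> sets M" for j a A
    using that by (simp add: L_def emeasure_density_const sets)
  show thesis
  proof
    show "kernel N M (L j)" for j
      unfolding kernel_def
    proof safe
      show "(\<lambda>a. emeasure (L j a) A) \<in> borel_measurable N" if [measurable]: "A \<in> sets M" for A
        by (subst measurable_cong[OF L]) auto
    qed (simp_all add: L_def sets)
    show "emeasure (L j a) (space M) \<le> 1" if "a \<in> space N" for j a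
      using that w_bound[OF m_nonneg, of j a] w_nonneg[OF m_nonneg, of j a] m_nonneg[of a]
      by (simp add: L em flip: ennreal_mult)
    show "emeasure (K a) A = (\<Sum>j. emeasure (L j a) A)" if a: "a \<in> space N" and A: "A \<in> sets M" for a A
    \<comment> \<open>At mass zero every share is 0 by the convention for division by zero, so the
      shares do not sum to 1; but there \<open>K a\<close> is null and both sides vanish.\<close>
    proof (cases "m a = 0")
      case True
      have "emeasure (K a) A \<le> emeasure (K a) (space M)"
        using a A sets.sets_into_space[OF A] by (intro emeasure_mono) (auto simp: sets)
      then have "emeasure (K a) A = 0" using em[OF a] True by simp
      then show ?thesis using L[OF a A] by simp
    next
      case False
      then have "(\<lambda>j. w j (m a)) sums 1" using m_nonneg[of a] by (intro w_sums) simp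
      then have "(\<Sum>j. ennreal (w j (m a))) = 1"
        using w_nonneg[OF m_nonneg] by (simp add: suminf_ennreal2 sums_iff)
      then show ?thesis by (simp add: L[OF a A])
    qed
  qed
qed

text \<open>The uniform bound makes the pieces stable under composition.\<close>

lemma s_finite_kernel_bounded_decomposition:
  assumes K: "s_finite_kernel N M K"
  obtains L :: "nat \<Rightarrow> 'a \<Rightarrow> 'b measure"
  where "\<And>i. kernel N M (L i)"
    and "\<And>i a. a \<in> space N \<Longrightarrow> emeasure (L i a) (space M) \<le> 1"
    and "\<And>a A. a \<in> space N \<Longrightarrow> A \<in> sets M \<Longrightarrow> emeasure (K a) A = (\<Sum>i. emeasure (L i a) A)"
proof -
  obtain F :: "nat \<Rightarrow> _" where "\<And>i. finite_kernel N M (F i)"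
    and F: "\<And>a A. a \<in> space N \<Longrightarrow> A \<in> sets M \<Longrightarrow> emeasure (K a) A = (\<Sum>i. emeasure (F i a) A)"
    using K unfolding s_finite_kernel_def by blast
  have "\<exists>L :: nat \<Rightarrow> 'a \<Rightarrow> 'b measure. (\<forall>j. kernel N M (L j)) \<and>
      (\<forall>j. \<forall>a\<in>space N. emeasure (L j a) (space M) \<le> 1) \<and>
      (\<forall>a\<in>space N. \<forall>A\<in>sets M. emeasure (F i a) A = (\<Sum>j. emeasure (L j a) A))" for i
    using finite_kernel_bounded_decomposition[OF \<open>finite_kernel N M (F i)\<close>] by metis
  then obtain L :: "nat \<Rightarrow> nat \<Rightarrow> 'a \<Rightarrow> 'b measure" where L: "\<And>i j. kernel N M (L i j)"
      "\<And>i j a. a \<in> space N \<Longrightarrow> emeasure (L i j a) (space M) \<le> 1"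
      "\<And>i a A. a \<in> space N \<Longrightarrow> A \<in> sets M \<Longrightarrow> emeasure (F i a) A = (\<Sum>j. emeasure (L i j a) A)"
    by metis
  show thesis
  proof
    show "kernel N M (case prod_decode n of (i, j) \<Rightarrow> L i j)" for n
      using L(1) by (simp split: prod.split)
    show "emeasure ((case prod_decode n of (i, j) \<Rightarrow> L i j) a) (space M) \<le> 1" if "a \<in> space N" for n a
      using L(2) that by (simp split: prod.split)
    show "emeasure (K a) A = (\<Sum>n. emeasure ((case prod_decode n of (i, j) \<Rightarrow> L i j) a) A)"
      if "a \<in> space N" "A \<in> sets M" for a A
      using suminf_ennreal_2dimen[of "\<lambda>i. emeasure (F i a) A" "\<lambda>(i, j). emeasure (L i j a) A"] L(3) F that
      by (simp add: case_prod_unfold)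
  qed
qed

section \<open>Closure properties of s-finite kernels\<close>

lemma s_finite_kernelI_bounded:
  assumes "kernel N M K" "\<And>i :: nat. kernel N M (L i)"
    and "\<And>i a. a \<in> space N \<Longrightarrow> emeasure (L i a) (space M) \<le> 1"
    and "\<And>a A. a \<in> space N \<Longrightarrow> A \<in> sets M \<Longrightarrow> emeasure (K a) A = (\<Sum>i. emeasure (L i a) A)"
  shows "s_finite_kernel N M K"
proof -
  have "finite_measure (L i a)" if "a \<in> space N" for i a
  proof
    have "space (L i a) = space M"
      using assms(2) that by (intro sets_eq_imp_space_eq) (auto simp: kernel_def)
    then show "emeasure (L i a) (space (L i a)) \<noteq> \<infinity>"
      using assms(3)[OF that, of i] by (auto simp: top_unique)
  qed
  then show ?thesis
    using assms unfolding s_finite_kernel_def finite_kernel_def by blast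
qed

lemma s_finite_kernel_pullback:
  assumes K: "s_finite_kernel N M K" and g: "g \<in> measurable N' N"
  shows "s_finite_kernel N' M (\<lambda>a. K (g a))"
proof -
  have *: "kernel N' M (\<lambda>a. L (g a))" if "kernel N M L" for L
    using that measurable_space[OF g] by (auto simp: kernel_def intro!: measurable_compose[OF g])
  from K obtain L :: "nat \<Rightarrow> _" where "\<And>i. finite_kernel N M (L i)"
    and "\<And>a A. a \<in> space N \<Longrightarrow> A \<in> sets M \<Longrightarrow> emeasure (K a) A = (\<Sum>i. emeasure (L i a) A)"
    unfolding s_finite_kernel_def by blast
  with K * measurable_space[OF g] show ?thesis
    unfolding s_finite_kernel_def finite_kernel_def
    by (intro conjI exI[of _ "\<lambda>i a. L i (g a)"]) auto
qed

text \<open>The mask is a set of parameters and does not touch the target variable. It serves to put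
  the time constraints, which link all earlier integration variables, onto the last kernel of a
  composition.\<close>

lemma s_finite_kernel_indicator:
  assumes K: "s_finite_kernel N M K" and B: "B \<in> sets N"
  shows "s_finite_kernel N M (\<lambda>a. density (K a) (\<lambda>_. indicator B a))"
proof -
  have ind: "emeasure (density (L a) (\<lambda>_. indicator B a)) A = indicator B a * emeasure (L a) A"
    if "kernel N M L" "a \<in> space N" "A \<in> sets M" for L a A
    using that by (simp add: emeasure_density_const kernel_def)
  have *: "kernel N M (\<lambda>a. density (L a) (\<lambda>_. indicator B a))" if L: "kernel N M L" for L
    unfolding kernel_def
  proof safe
    fix A assume A: "A \<in> sets M"
    then have [measurable]: "(\<lambda>a. emeasure (L a) A) \<in> borel_measurable N" using L by (simp add: kernel_def)
    show "(\<lambda>a. emeasure (density (L a) (\<lambda>_. indicator B a)) A) \<in> borel_measurable N"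
      using B A by (subst measurable_cong[OF ind[OF L]]) auto
  qed (use L in \<open>simp_all add: kernel_def\<close>)
  have **: "finite_kernel N M (\<lambda>a. density (L a) (\<lambda>_. indicator B a))" if L: "finite_kernel N M L" for L
  proof -
    have "finite_measure (density (L a) (\<lambda>_. indicator B a))" if a: "a \<in> space N" for a
    proof
      have "finite_measure (L a)" using L a by (simp add: finite_kernel_def)
      then show "emeasure (density (L a) (\<lambda>_. indicator B a)) (space (density (L a) (\<lambda>_. indicator B a))) \<noteq> \<infinity>"
        by (simp add: emeasure_density_const indicator_def finite_measure.emeasure_finite)
    qed
    with * L show ?thesis by (auto simp: finite_kernel_def)
  qed
  from K obtain L :: "nat \<Rightarrow> _" where L: "\<And>i. finite_kernel N M (L i)"
    and "\<And>a A. a \<in> space N \<Longrightarrow> A \<in> sets M \<Longrightarrow> emeasure (K a) A = (\<Sum>i. emeasure (L i a) A)"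
    unfolding s_finite_kernel_def by blast
  then have "emeasure (density (K a) (\<lambda>_. indicator B a)) A
      = (\<Sum>i. emeasure (density (L i a) (\<lambda>_. indicator B a)) A)" if "a \<in> space N" "A \<in> sets M" for a A
    using that K ind by (simp add: s_finite_kernel_def finite_kernel_def)
  with * ** L K show ?thesis
    unfolding s_finite_kernel_def
    by (intro conjI exI[of _ "\<lambda>i a. density (L i a) (\<lambda>_. indicator B a)"]) auto
qed

text \<open>Lets the time integration count as one more kernel in a composition; a disjoint
  partition into sets of finite measure supplies the pieces.\<close>

lemma s_finite_kernel_const:
  assumes "sigma_finite_measure \<mu>" and sets: "sets \<mu> = sets M"
  shows "s_finite_kernel N M (\<lambda>_. \<mu>)"
proof -
  interpret sigma_finite_measure \<mu> by fact
  obtain F :: "nat \<Rightarrow> 'a set" where F: "range F \<subseteq> sets \<mu>" "\<Union> (range F) = space \<mu>"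
    "\<And>i. emeasure \<mu> (F i) \<noteq> \<infinity>" "disjoint_family F"
    by (rule sigma_finite_disjoint) blast
  have "finite_measure (density \<mu> (indicator (F i)))" for i
    using F by (intro finite_measureI) (auto simp: emeasure_restricted subset_eq)
  moreover have "emeasure \<mu> A = (\<Sum>i. emeasure (density \<mu> (indicator (F i))) A)"
    if A: "A \<in> sets \<mu>" for A
  proof -
    have "emeasure \<mu> A = emeasure \<mu> (\<Union>i. F i \<inter> A)"
      using F(2) sets.sets_into_space[OF A] by (auto intro!: arg_cong[where f = "emeasure \<mu>"])
    also have "\<dots> = (\<Sum>i. emeasure \<mu> (F i \<inter> A))"
      using F A by (intro suminf_emeasure[symmetric])
        (auto intro: disjoint_family_on_bisimulation[OF F(4)])
    finally show ?thesis using F(1) A by (simp add: emeasure_restricted subset_eq)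
  qed
  ultimately show ?thesis
    unfolding s_finite_kernel_def finite_kernel_def kernel_def
    by (intro conjI exI[of _ "\<lambda>i _. density \<mu> (indicator (F i))"]) (auto simp: sets)
qed

lemma finite_kernel_imp_s_finite_kernel:
  assumes K: "finite_kernel N M K"
  shows "s_finite_kernel N M K"
proof -
  let ?L = "\<lambda>i :: nat. if i = 0 then K else (\<lambda>_. null_measure M)"
  have "finite_kernel N M (?L i)" for i
    using K by (auto simp: finite_kernel_def kernel_def intro: finite_measureI)
  moreover have "emeasure (K a) A = (\<Sum>i. emeasure (?L i a) A)" for a A
    using sums_unique[OF sums_single[of "0 :: nat" "\<lambda>_. emeasure (K a) A"]]
    by (simp add: if_distrib if_distribR cong: if_cong)
  ultimately show ?thesis
    using K unfolding s_finite_kernel_def finite_kernel_def by (intro conjI exI[of _ ?L]) auto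
qed

lemma s_finite_kernel_cong:
  assumes K: "s_finite_kernel N M K" and eq: "\<And>a. a \<in> space N \<Longrightarrow> K' a = K a"
  shows "s_finite_kernel N M K'"
  using K unfolding s_finite_kernel_def kernel_def by (simp add: eq cong: measurable_cong)

lemma s_finite_kernel_measurable_section:
  assumes "s_finite_kernel N M K" "a \<in> space N" "f \<in> borel_measurable (N \<Otimes>\<^sub>M M)"
  shows "(\<lambda>b. f (a, b)) \<in> borel_measurable (K a)"
  using assms by (simp add: measurable_cong_sets[OF s_finite_kernel_sets refl] measurable_Pair2)

section \<open>Composition of kernels and iterated integrals\<close>

text \<open>\<open>L\<close> sees the old parameter \<open>a\<close> besides the integrated point
  \<open>b\<close>, because later kernels in a chain need the end time and all intermediate times.
  For a set function that is not a measure, \<open>measure_of\<close> would yield the null measure;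
  the next lemma but one excludes this.\<close>

definition kernel_comp ::
  "'c measure \<Rightarrow> ('a \<Rightarrow> 'b measure) \<Rightarrow> ('a \<times> 'b \<Rightarrow> 'c measure) \<Rightarrow> 'a \<Rightarrow> 'c measure" where
  "kernel_comp P K L a = measure_of (space P) (sets P) (\<lambda>A. \<integral>\<^sup>+b. emeasure (L (a, b)) A \<partial>K a)"

lemma sets_kernel_comp [simp, measurable_cong]: "sets (kernel_comp P K L a) = sets P"
  by (simp add: kernel_comp_def)

lemma measure_space_kernel_comp:
  assumes "kernel N M K" and L: "kernel (N \<Otimes>\<^sub>M M) P L" and a: "a \<in> space N"
  shows "measure_space (space P) (sets P) (\<lambda>A. \<integral>\<^sup>+b. emeasure (L (a, b)) A \<partial>K a)"
  unfolding measure_space_def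
proof (intro conjI)
  have K: "sets (K a) = sets M" using assms by (simp add: kernel_def)
  show "sigma_algebra (space P) (sets P)" ..
  show "positive (sets P) (\<lambda>A. \<integral>\<^sup>+b. emeasure (L (a, b)) A \<partial>K a)"
    by (simp add: positive_def)
  show "countably_additive (sets P) (\<lambda>A. \<integral>\<^sup>+b. emeasure (L (a, b)) A \<partial>K a)"
  proof (rule countably_additiveI)
    fix A :: "nat \<Rightarrow> 'c set" assume A: "range A \<subseteq> sets P" "disjoint_family A"
    have "(\<lambda>b. emeasure (L (a, b)) (A i)) \<in> borel_measurable (K a)" for i
      using L a A(1) unfolding measurable_cong_sets[OF K refl]
      by (intro measurable_Pair2[OF _ a]) (auto simp: kernel_def)
    then have "(\<Sum>i. \<integral>\<^sup>+b. emeasure (L (a, b)) (A i) \<partial>K a) = (\<integral>\<^sup>+b. (\<Sum>i. emeasure (L (a, b)) (A i)) \<partial>K a)"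
      by (rule nn_integral_suminf[symmetric])
    also have "\<dots> = (\<integral>\<^sup>+b. emeasure (L (a, b)) (\<Union>i. A i) \<partial>K a)"
      using L a A sets_eq_imp_space_eq[OF K]
      by (intro nn_integral_cong suminf_emeasure) (auto simp: kernel_def space_pair_measure)
    finally show "(\<Sum>i. \<integral>\<^sup>+b. emeasure (L (a, b)) (A i) \<partial>K a) = (\<integral>\<^sup>+b. emeasure (L (a, b)) (\<Union>i. A i) \<partial>K a)" .
  qed
qed

lemma emeasure_kernel_comp:
  assumes "kernel N M K" "kernel (N \<Otimes>\<^sub>M M) P L" "a \<in> space N" "A \<in> sets P"
  shows "emeasure (kernel_comp P K L a) A = (\<integral>\<^sup>+b. emeasure (L (a, b)) A \<partial>K a)"
  using measure_space_kernel_comp[OF assms(1-3)] assms(4)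
  unfolding kernel_comp_def by (intro emeasure_measure_of_sigma) (auto simp: measure_space_def)

text \<open>Composing merely finite kernels may produce infinite mass, as the total mass of
  \<open>L (a, b)\<close> can be unbounded in \<open>b\<close>. Pieces of mass at most 1 compose to
  mass at most 1, and the double family of compositions is enumerated by
  \<open>prod_decode\<close>.\<close>

lemma s_finite_kernel_comp:
  assumes K: "s_finite_kernel N M K" and L: "s_finite_kernel (N \<Otimes>\<^sub>M M) P L"
  shows "s_finite_kernel N P (kernel_comp P K L)"
proof -
  obtain K' where K': "\<And>i :: nat. kernel N M (K' i)"
      "\<And>i a. a \<in> space N \<Longrightarrow> emeasure (K' i a) (space M) \<le> 1"
    and eqK: "\<And>a A. a \<in> space N \<Longrightarrow> A \<in> sets M \<Longrightarrow> emeasure (K a) A = (\<Sum>i. emeasure (K' i a) A)"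
    using s_finite_kernel_bounded_decomposition[OF K] by blast
  obtain L' where L': "\<And>i :: nat. kernel (N \<Otimes>\<^sub>M M) P (L' i)"
      "\<And>i a. a \<in> space (N \<Otimes>\<^sub>M M) \<Longrightarrow> emeasure (L' i a) (space P) \<le> 1"
    and eqL: "\<And>a A. a \<in> space (N \<Otimes>\<^sub>M M) \<Longrightarrow> A \<in> sets P \<Longrightarrow> emeasure (L a) A = (\<Sum>i. emeasure (L' i a) A)"
    using s_finite_kernel_bounded_decomposition[OF L] by blast
  have K'_sets: "\<And>i a. a \<in> space N \<Longrightarrow> sets (K' i a) = sets M"
    using K'(1) by (simp add: kernel_def)
  have K'_space: "\<And>i a. a \<in> space N \<Longrightarrow> space (K' i a) = space M"
    using K'_sets by (rule sets_eq_imp_space_eq)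
  have fin: "finite_kernel N M (K' i)" for i
    unfolding finite_kernel_def
  proof (safe intro!: K'(1) finite_measureI)
    fix a assume "a \<in> space N" "emeasure (K' i a) (space (K' i a)) = \<infinity>"
    then show False using K'(2)[of a i] by (simp add: K'_space top_unique)
  qed
  \<comment> \<open>Stated for a fresh pair \<open>K\<close>, \<open>L\<close>, since it is needed
    for the whole kernels and again for each pair of pieces.\<close>
  have comp: "kernel N P (kernel_comp P K L)" if K: "s_finite_kernel N M K" and L: "kernel (N \<Otimes>\<^sub>M M) P L" for K L
    unfolding kernel_def
  proof safe
    fix A assume A: "A \<in> sets P"
    have "(\<lambda>a. \<integral>\<^sup>+b. emeasure (L (a, b)) A \<partial>K a) \<in> borel_measurable N"
      using L A by (intro s_finite_kernel_measurable_nn_integral[OF K]) (simp add: kernel_def)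
    then show "(\<lambda>a. emeasure (kernel_comp P K L a) A) \<in> borel_measurable N"
      using emeasure_kernel_comp[OF _ L _ A, of K] K by (simp add: s_finite_kernel_def cong: measurable_cong)
  qed simp_all
  have K_kernel: "kernel N M K" using K by (simp add: s_finite_kernel_def)
  have L_kernel: "kernel (N \<Otimes>\<^sub>M M) P L" using L by (simp add: s_finite_kernel_def)
  show ?thesis
  proof (rule s_finite_kernelI_bounded[OF comp[OF K L_kernel]])
    show "kernel N P (case prod_decode n of (i, j) \<Rightarrow> kernel_comp P (K' i) (L' j))" for n
      using comp[OF finite_kernel_imp_s_finite_kernel[OF fin] L'(1)] by (simp split: prod.split)
    show "emeasure ((case prod_decode n of (i, j) \<Rightarrow> kernel_comp P (K' i) (L' j)) a) (space P) \<le> 1"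
      if a: "a \<in> space N" for n a
    proof -
      have "emeasure (kernel_comp P (K' i) (L' j) a) (space P) \<le> 1" for i j
      proof -
        have "emeasure (kernel_comp P (K' i) (L' j) a) (space P) = (\<integral>\<^sup>+b. emeasure (L' j (a, b)) (space P) \<partial>K' i a)"
          using a by (intro emeasure_kernel_comp[OF K'(1) L'(1)]) auto
        also have "\<dots> \<le> (\<integral>\<^sup>+b. 1 \<partial>K' i a)"
          using a by (intro nn_integral_mono L'(2)) (simp add: space_pair_measure K'_space)
        also have "\<dots> \<le> 1" using K'(2)[OF a] by (simp add: K'_space a)
        finally show ?thesis .
      qed
      then show ?thesis by (simp split: prod.split)
    qed
    show "emeasure (kernel_comp P K L a) A
        = (\<Sum>n. emeasure ((case prod_decode n of (i, j) \<Rightarrow> kernel_comp P (K' i) (L' j)) a) A)"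
      if a: "a \<in> space N" and A: "A \<in> sets P" for a A
    proof -
      have meas: "(\<lambda>b. emeasure (L' j (a, b)) A) \<in> borel_measurable M" for j
        using L'(1) a A by (intro measurable_Pair2[OF _ a]) (auto simp: kernel_def)
      have "emeasure (kernel_comp P K L a) A = (\<integral>\<^sup>+b. emeasure (L (a, b)) A \<partial>K a)"
        by (rule emeasure_kernel_comp[OF K_kernel L_kernel a A])
      also have "\<dots> = (\<Sum>i. \<integral>\<^sup>+b. emeasure (L (a, b)) A \<partial>K' i a)"
      proof (rule nn_integral_suminf_measure)
        show "(\<lambda>b. emeasure (L (a, b)) A) \<in> borel_measurable (K a)"
          using L_kernel A
          by (intro s_finite_kernel_measurable_section[OF K a]) (simp add: kernel_def)
      qed (simp_all add: s_finite_kernel_sets[OF K a] K'_sets[OF a] eqK[OF a])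
      also have "\<dots> = (\<Sum>i. \<Sum>j. \<integral>\<^sup>+b. emeasure (L' j (a, b)) A \<partial>K' i a)"
        using a A meas
        by (auto simp: eqL space_pair_measure K'_space measurable_cong_sets[OF K'_sets refl]
            nn_integral_suminf[symmetric] intro!: suminf_cong nn_integral_cong)
      also have "\<dots> = (\<Sum>i. \<Sum>j. emeasure (kernel_comp P (K' i) (L' j) a) A)"
        by (simp add: emeasure_kernel_comp[OF K'(1) L'(1) a A])
      also have "\<dots> = (\<Sum>n. (\<lambda>(i, j). emeasure (kernel_comp P (K' i) (L' j) a) A) (prod_decode n))"
        by (rule suminf_ennreal_2dimen[symmetric]) simp
      finally show ?thesis by (simp add: case_prod_unfold)
    qed
  qed
qed

text \<open>General integrands are required, not only indicators: unfolding two steps of the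
  recursion integrates \<open>jump_integral\<close> against a composition.\<close>

lemma nn_integral_kernel_comp:
  assumes K: "s_finite_kernel N M K" and L: "s_finite_kernel (N \<Otimes>\<^sub>M M) P L"
    and a: "a \<in> space N" and f: "f \<in> borel_measurable P"
  shows "(\<integral>\<^sup>+c. f c \<partial>kernel_comp P K L a) = (\<integral>\<^sup>+b. \<integral>\<^sup>+c. f c \<partial>L (a, b) \<partial>K a)"
proof -
  have ab: "(a, b) \<in> space (N \<Otimes>\<^sub>M M)" if "b \<in> space (K a)" for b
    using that a s_finite_kernel_space[OF K a] by (simp add: space_pair_measure)
  have inner: "(\<lambda>b. \<integral>\<^sup>+c. g c \<partial>L (a, b)) \<in> borel_measurable (K a)" if "g \<in> borel_measurable P" for g
    using that
    by (intro s_finite_kernel_measurable_section[OF K a]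
        s_finite_kernel_measurable_nn_integral[OF L, where f = "\<lambda>p. g (snd p)", simplified]) auto
  have LP: "g \<in> borel_measurable (L (a, b))" if "g \<in> borel_measurable P" "b \<in> space (K a)" for g b
    using that by (simp add: measurable_cong_sets[OF s_finite_kernel_sets[OF L ab] refl])
  show ?thesis using f
  proof (induct rule: borel_measurable_induct)
    case (cong f g)
    have "space (kernel_comp P K L a) = space P" by (rule sets_eq_imp_space_eq) simp
    then have "(\<integral>\<^sup>+c. f c \<partial>kernel_comp P K L a) = (\<integral>\<^sup>+c. g c \<partial>kernel_comp P K L a)"
      using cong(3) by (intro nn_integral_cong) simp
    moreover have "(\<integral>\<^sup>+b. \<integral>\<^sup>+c. f c \<partial>L (a, b) \<partial>K a) = (\<integral>\<^sup>+b. \<integral>\<^sup>+c. g c \<partial>L (a, b) \<partial>K a)"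
      using cong(3) by (intro nn_integral_cong) (simp add: s_finite_kernel_space[OF L ab])
    ultimately show ?case using cong(4) by simp
  next
    case (set A)
    have "(\<integral>\<^sup>+b. emeasure (L (a, b)) A \<partial>K a) = (\<integral>\<^sup>+b. \<integral>\<^sup>+c. indicator A c \<partial>L (a, b) \<partial>K a)"
      using set by (intro nn_integral_cong) (simp add: s_finite_kernel_sets[OF L ab])
    then show ?case
      using set emeasure_kernel_comp[OF _ _ a set, of M K L] K L
      by (simp add: s_finite_kernel_def)
  next
    case (mult u c)
    have "(\<integral>\<^sup>+b. \<integral>\<^sup>+x. c * u x \<partial>L (a, b) \<partial>K a) = (\<integral>\<^sup>+b. c * \<integral>\<^sup>+x. u x \<partial>L (a, b) \<partial>K a)"
      using mult by (intro nn_integral_cong nn_integral_cmult LP)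
    with mult inner[of u] show ?case by (simp add: nn_integral_cmult)
  next
    case (add u v)
    have "(\<integral>\<^sup>+b. \<integral>\<^sup>+x. v x + u x \<partial>L (a, b) \<partial>K a)
        = (\<integral>\<^sup>+b. (\<integral>\<^sup>+x. v x \<partial>L (a, b)) + (\<integral>\<^sup>+x. u x \<partial>L (a, b)) \<partial>K a)"
      using add by (intro nn_integral_cong nn_integral_add LP)
    with add inner[of u] inner[of v] show ?case by (simp add: nn_integral_add)
  next
    case (seq U)
    have inc: "incseq (\<lambda>i b. \<integral>\<^sup>+x. U i x \<partial>L (a, b))"
      using incseqD[OF seq(4)] by (auto simp: incseq_def le_fun_def intro!: nn_integral_mono)
    have "(\<integral>\<^sup>+b. \<integral>\<^sup>+x. (SUP i. U i x) \<partial>L (a, b) \<partial>K a) = (\<integral>\<^sup>+b. (SUP i. \<integral>\<^sup>+x. U i x \<partial>L (a, b)) \<partial>K a)"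
      using seq by (intro nn_integral_cong nn_integral_monotone_convergence_SUP LP)
    also have "\<dots> = (SUP i. \<integral>\<^sup>+b. \<integral>\<^sup>+x. U i x \<partial>L (a, b) \<partial>K a)"
      by (rule nn_integral_monotone_convergence_SUP[OF inc inner[OF seq(1)]])
    finally show ?case
      using seq by (simp add: image_comp nn_integral_monotone_convergence_SUP)
  qed
qed

text \<open>Only \<open>K a\<close> is decomposed: a finite piece and the sigma-finite \<mu> fall
  under the classical theorem, and the sum over the pieces passes through both orders of
  integration.\<close>

lemma s_finite_kernel_Tonelli:
  assumes K: "s_finite_kernel N M K" and a: "a \<in> space N"
    and "sigma_finite_measure \<mu>" and f: "case_prod f \<in> borel_measurable (M \<Otimes>\<^sub>M \<mu>)"
  shows "(\<integral>\<^sup>+b. \<integral>\<^sup>+v. f b v \<partial>\<mu> \<partial>K a) = (\<integral>\<^sup>+v. \<integral>\<^sup>+b. f b v \<partial>K a \<partial>\<mu>)"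
proof -
  interpret \<mu>: sigma_finite_measure \<mu> by fact
  obtain L :: "nat \<Rightarrow> _" where fin: "\<And>i. finite_kernel N M (L i)"
    and L: "\<And>A. A \<in> sets M \<Longrightarrow> emeasure (K a) A = (\<Sum>i. emeasure (L i a) A)"
    using K a unfolding s_finite_kernel_def by blast
  have sets: "sets (L i a) = sets M" "sets (K a) = sets M" for i
    using fin K a by (auto simp: finite_kernel_def kernel_def s_finite_kernel_def)
  have sum: "(\<integral>\<^sup>+b. g b \<partial>K a) = (\<Sum>i. \<integral>\<^sup>+b. g b \<partial>L i a)" if "g \<in> borel_measurable M" for g
    using that by (intro nn_integral_suminf_measure) (simp_all add: sets L measurable_cong_sets[OF sets(2) refl])
  have f1: "(\<lambda>b. \<integral>\<^sup>+v. f b v \<partial>\<mu>) \<in> borel_measurable M"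
    using f by (rule \<mu>.borel_measurable_nn_integral)
  have f2: "(\<lambda>b. f b v) \<in> borel_measurable M" if "v \<in> space \<mu>" for v
    using measurable_Pair1[OF f that] by simp
  have fL: "case_prod f \<in> borel_measurable (L i a \<Otimes>\<^sub>M \<mu>)" for i
    using f by (simp add: measurable_cong_sets[OF sets_pair_measure_cong[OF sets(1) refl] refl])
  have swap: "(\<integral>\<^sup>+b. \<integral>\<^sup>+v. f b v \<partial>\<mu> \<partial>L i a) = (\<integral>\<^sup>+v. \<integral>\<^sup>+b. f b v \<partial>L i a \<partial>\<mu>)"
    and meas: "(\<lambda>v. \<integral>\<^sup>+b. f b v \<partial>L i a) \<in> borel_measurable \<mu>" for i
  proof -
    interpret finite_measure "L i a" using fin a by (simp add: finite_kernel_def)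
    have L_sigma_finite: "sigma_finite_measure (L i a)" ..
    interpret pair_sigma_finite "L i a" \<mu> ..
    show "(\<integral>\<^sup>+b. \<integral>\<^sup>+v. f b v \<partial>\<mu> \<partial>L i a) = (\<integral>\<^sup>+v. \<integral>\<^sup>+b. f b v \<partial>L i a \<partial>\<mu>)"
      using Fubini'[OF fL] by simp
    have "(\<lambda>(v, b). f b v) \<in> borel_measurable (\<mu> \<Otimes>\<^sub>M L i a)"
      using fL by (subst measurable_pair_swap_iff) simp
    then show "(\<lambda>v. \<integral>\<^sup>+b. f b v \<partial>L i a) \<in> borel_measurable \<mu>"
      by (rule sigma_finite_measure.borel_measurable_nn_integral[OF L_sigma_finite])
  qed
  have "(\<integral>\<^sup>+b. \<integral>\<^sup>+v. f b v \<partial>\<mu> \<partial>K a) = (\<Sum>i. \<integral>\<^sup>+v. \<integral>\<^sup>+b. f b v \<partial>L i a \<partial>\<mu>)"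
    by (simp add: sum[OF f1] swap)
  also have "\<dots> = (\<integral>\<^sup>+v. (\<Sum>i. \<integral>\<^sup>+b. f b v \<partial>L i a) \<partial>\<mu>)"
    by (intro nn_integral_suminf[symmetric] meas)
  also have "\<dots> = (\<integral>\<^sup>+v. \<integral>\<^sup>+b. f b v \<partial>K a \<partial>\<mu>)"
    by (intro nn_integral_cong) (simp add: sum f2)
  finally show ?thesis .
qed

section \<open>Comparing measures, and measures given by set functions\<close>

text \<open>The right side is an integral against the constant density \<open>c\<close>, so this is
  monotonicity in the measure. It carries the induction hypothesis, an inequality between measures,
  over to integrals of \<open>jump_integral\<close>.\<close>

lemma nn_integral_le_of_emeasure_le:
  assumes sets: "sets N = sets K" and le: "\<And>A. A \<in> sets K \<Longrightarrow> emeasure N A \<le> c * emeasure K A"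
    and f [measurable]: "f \<in> borel_measurable K"
  shows "(\<integral>\<^sup>+x. f x \<partial>N) \<le> c * (\<integral>\<^sup>+x. f x \<partial>K)"
proof -
  have "N \<le> density K (\<lambda>_. c)"
    using sets le by (subst le_measure) (auto simp: emeasure_density_const)
  then have "(\<integral>\<^sup>+x. f x \<partial>N) \<le> (\<integral>\<^sup>+x. f x \<partial>density K (\<lambda>_. c))"
    using sets by (intro nn_integral_mono_measure) simp_all
  then show ?thesis by (simp add: nn_integral_density nn_integral_cmult)
qed

lemma measure_space_eqI:
  assumes "sets N = sets M" and "\<And>A. A \<in> sets M \<Longrightarrow> f A = emeasure N A"
  shows "measure_space (space M) (sets M) f"
  using measure_space[of N] sets_eq_imp_space_eq[OF assms(1)] assms
    measure_space_eq[of "sets M" "space M" f "emeasure N"]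
  by (simp add: sets.space_closed sets.sigma_sets_eq)

text \<open>This identifies the \<open>measure_of\<close> inside \<open>series_term\<close> with
  measures already constructed, so that its default value never enters.\<close>

lemma measure_of_sets_eq:
  assumes "sets N = sets M" "\<And>A. A \<in> sets M \<Longrightarrow> f A = emeasure N A"
  shows "measure_of (space M) (sets M) f = N"
proof -
  have "measure_of (space M) (sets M) f = measure_of (space M) (sets M) (emeasure N)"
    using assms by (intro measure_of_eq) (simp_all add: sets.space_closed sets.sigma_sets_eq)
  also have "\<dots> = N"
    using measure_of_of_measure[of N] assms(1) sets_eq_imp_space_eq[OF assms(1)] by simp
  finally show ?thesis .
qed

lemma measure_space_suminf:
  fixes f :: "nat \<Rightarrow> 'a set \<Rightarrow> ennreal"
  assumes f: "\<And>n. measure_space (space M) (sets M) (f n)"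
  shows "measure_space (space M) (sets M) (\<lambda>A. \<Sum>n. f n A)"
  unfolding measure_space_def
proof (intro conjI)
  show "sigma_algebra (space M) (sets M)" ..
  show "positive (sets M) (\<lambda>A. \<Sum>n. f n A)"
    using f by (simp add: measure_space_def positive_def)
  show "countably_additive (sets M) (\<lambda>A. \<Sum>n. f n A)"
  proof (rule countably_additiveI)
    fix A :: "nat \<Rightarrow> 'a set"
    assume A: "range A \<subseteq> sets M" "disjoint_family A" "(\<Union>i. A i) \<in> sets M"
    \<comment> \<open>Reading the sum over i as an integral against counting measure turns the
      exchange of the two sums into \<open>nn_integral_suminf\<close>.\<close>
    have "(\<Sum>i. \<Sum>n. f n (A i)) = (\<integral>\<^sup>+i. (\<Sum>n. f n (A i)) \<partial>count_space UNIV)"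
      by (simp add: nn_integral_count_space_nat)
    also have "\<dots> = (\<Sum>n. \<Sum>i. f n (A i))"
      by (subst nn_integral_suminf) (simp_all add: nn_integral_count_space_nat)
    also have "\<dots> = (\<Sum>n. f n (\<Union>i. A i))"
      using f A by (intro suminf_cong) (auto simp: measure_space_def countably_additive_def)
    finally show "(\<Sum>i. \<Sum>n. f n (A i)) = (\<Sum>n. f n (\<Union>i. A i))" .
  qed
qed

lemma s_finite_kernel_measurable_nn_integral_pullback:
  assumes "s_finite_kernel N M K" "g \<in> measurable N' N" "case_prod f \<in> borel_measurable (N' \<Otimes>\<^sub>M M)"
  shows "(\<lambda>a. \<integral>\<^sup>+b. f a b \<partial>K (g a)) \<in> borel_measurable N'"
  using s_finite_kernel_measurable_nn_integral[OF s_finite_kernel_pullback[OF assms(1,2)] assms(3)]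
  by simp

subsection \<open>The perturbation series\<close>

text \<open>The end time is a parameter of \<open>k\<close> on a par with (s,x), not a coordinate of
  the target: the terms are defined for each t separately, and pullbacks can then substitute
  integration variables for either time.\<close>

locale kernel_perturbation =
  fixes M :: "'a measure"
    and \<mu> :: "real measure"
    and J :: "real \<times> 'a \<Rightarrow> (real \<times> 'a) measure"
    and k :: "real \<Rightarrow> 'a \<Rightarrow> real \<Rightarrow> 'a measure"
  assumes J: "s_finite_kernel (spacetime M) (spacetime M) J"
    and k: "s_finite_kernel (spacetime M \<Otimes>\<^sub>M borel) M (\<lambda>((s, x), t). k s x t)"
    and \<mu>: "sigma_finite_measure \<mu>"
    and sets_\<mu> [measurable_cong]: "sets \<mu> = sets borel"
begin

lemma space_\<mu> [simp]: "space \<mu> = UNIV"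
  using sets_eq_imp_space_eq[OF sets_\<mu>] by simp

text \<open>\<open>perturb\<close> rewritten as a chain of compositions: \<mu> chooses u,
  \<open>l\<close> chooses z, \<open>J\<close> chooses the landing point p, and \<open>k\<close>
  leads from p to time t. All time constraints sit on the last kernel, so s-finiteness follows from
  the closure properties alone.\<close>

definition perturb_measure ::
  "(real \<Rightarrow> 'a \<Rightarrow> real \<Rightarrow> 'a measure) \<Rightarrow> (real \<times> 'a) \<times> real \<Rightarrow> 'a measure" where
  "perturb_measure l =
     kernel_comp M (\<lambda>_. \<mu>)
       (kernel_comp M (\<lambda>b. l (fst (fst (fst b))) (snd (fst (fst b))) (snd b))
         (kernel_comp M (\<lambda>c. J (snd (fst c), snd c))
           (\<lambda>(((((s, x), t), u), z), p). density (k (fst p) (snd p) t)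
              (\<lambda>_. indicator {(((((s, x), t), u), z), p). s < u \<and> u < t \<and> u < fst p \<and> fst p < t}
                     (((((s, x), t), u), z), p)))))"

lemma
  assumes l: "s_finite_kernel (spacetime M \<Otimes>\<^sub>M borel) M (\<lambda>((s, x), t). l s x t)"
  shows s_finite_kernel_perturb_measure:
      "s_finite_kernel (spacetime M \<Otimes>\<^sub>M borel) M (perturb_measure l)"
    and nn_integral_perturb_measure:
      "\<And>s x t f. x \<in> space M \<Longrightarrow> f \<in> borel_measurable M \<Longrightarrow>
        (\<integral>\<^sup>+y. f y \<partial>perturb_measure l ((s, x), t)) =
        (\<integral>\<^sup>+u. \<integral>\<^sup>+z. \<integral>\<^sup>+p. of_bool (s < u \<and> u < t \<and> u < fst p \<and> fst p < t) *
            (\<integral>\<^sup>+y. f y \<partial>k (fst p) (snd p) t) \<partial>J (u, z) \<partial>l s x u \<partial>\<mu>)"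
proof -
  let ?N0 = "spacetime M \<Otimes>\<^sub>M (borel :: real measure)"
  let ?N1 = "?N0 \<Otimes>\<^sub>M (borel :: real measure)"
  let ?N2 = "?N1 \<Otimes>\<^sub>M M"
  let ?N3 = "?N2 \<Otimes>\<^sub>M spacetime M"
  let ?B = "{(((((s, x), t), u), z), p). s < u \<and> u < t \<and> u < fst p \<and> fst p < t}
    :: (((((real \<times> 'a) \<times> real) \<times> real) \<times> 'a) \<times> (real \<times> 'a)) set"
  let ?K3 = "\<lambda>(((((s, x), t), u), z), p). density (k (fst p) (snd p) t)
              (\<lambda>_. indicator ?B (((((s, x), t), u), z), p))"
  let ?K2 = "\<lambda>c. J (snd (fst c), snd c)"
  let ?K1 = "\<lambda>b. l (fst (fst (fst b))) (snd (fst (fst b))) (snd b)"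
  have "s_finite_kernel ?N3 M (\<lambda>d. (\<lambda>((s, x), t). k s x t) (snd d, snd (fst (fst (fst d)))))"
    by (rule s_finite_kernel_pullback[OF k]) measurable
  \<comment> \<open>The set \<open>?B\<close> also contains tuples with points outside
    \<open>space M\<close>, so only its trace on the product space is measurable;
    \<open>s_finite_kernel_cong\<close> later removes the difference.\<close>
  moreover have "{d \<in> space ?N3. d \<in> ?B} \<in> sets ?N3"
    unfolding mem_Collect_eq case_prod_unfold by measurable
  ultimately have "s_finite_kernel ?N3 M (\<lambda>d. density ((\<lambda>((s, x), t). k s x t) (snd d, snd (fst (fst (fst d)))))
      (\<lambda>_. indicator {d \<in> space ?N3. d \<in> ?B} d))"
    by (rule s_finite_kernel_indicator)
  then have K3: "s_finite_kernel ?N3 M ?K3"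
    by (rule s_finite_kernel_cong) (auto simp: indicator_def case_prod_unfold)
  have K2: "s_finite_kernel ?N2 (spacetime M) ?K2"
    by (rule s_finite_kernel_pullback[OF J]) measurable
  have "s_finite_kernel ?N1 M (\<lambda>b. (\<lambda>((s, x), t). l s x t) (fst (fst b), snd b))"
    by (rule s_finite_kernel_pullback[OF l]) measurable
  then have K1: "s_finite_kernel ?N1 M ?K1"
    by (simp add: case_prod_unfold)
  have K0: "s_finite_kernel ?N0 borel (\<lambda>_. \<mu>)"
    by (rule s_finite_kernel_const[OF \<mu> sets_\<mu>])
  note C3 = s_finite_kernel_comp[OF K2 K3]
  note C2 = s_finite_kernel_comp[OF K1 C3]
  show "s_finite_kernel ?N0 M (perturb_measure l)"
    unfolding perturb_measure_def by (rule s_finite_kernel_comp[OF K0 C2])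
  fix s x t and f :: "'a \<Rightarrow> ennreal"
  assume x: "x \<in> space M" and f: "f \<in> borel_measurable M"
  have a: "((s, x), t) \<in> space ?N0" using x by (simp add: space_pair_measure)
  show "(\<integral>\<^sup>+y. f y \<partial>perturb_measure l ((s, x), t)) =
        (\<integral>\<^sup>+u. \<integral>\<^sup>+z. \<integral>\<^sup>+p. of_bool (s < u \<and> u < t \<and> u < fst p \<and> fst p < t) *
            (\<integral>\<^sup>+y. f y \<partial>k (fst p) (snd p) t) \<partial>J (u, z) \<partial>l s x u \<partial>\<mu>)"
    unfolding perturb_measure_def nn_integral_kernel_comp[OF K0 C2 a f]
  proof (rule nn_integral_cong)
    fix u assume "u \<in> space \<mu>"
    have b: "(((s, x), t), u) \<in> space ?N1" using a by (simp add: space_pair_measure)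
    show "(\<integral>\<^sup>+y. f y \<partial>kernel_comp M ?K1 (kernel_comp M ?K2 ?K3) (((s, x), t), u)) =
        (\<integral>\<^sup>+z. \<integral>\<^sup>+p. of_bool (s < u \<and> u < t \<and> u < fst p \<and> fst p < t) *
            (\<integral>\<^sup>+y. f y \<partial>k (fst p) (snd p) t) \<partial>J (u, z) \<partial>l s x u)"
      unfolding nn_integral_kernel_comp[OF K1 C3 b f] fst_conv snd_conv
    proof (rule nn_integral_cong)
      fix z assume "z \<in> space (l s x u)"
      then have c: "((((s, x), t), u), z) \<in> space ?N2"
        using b s_finite_kernel_space[OF K1 b] by (simp add: space_pair_measure)
      show "(\<integral>\<^sup>+y. f y \<partial>kernel_comp M ?K2 ?K3 ((((s, x), t), u), z)) =
        (\<integral>\<^sup>+p. of_bool (s < u \<and> u < t \<and> u < fst p \<and> fst p < t) *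
            (\<integral>\<^sup>+y. f y \<partial>k (fst p) (snd p) t) \<partial>J (u, z))"
        unfolding nn_integral_kernel_comp[OF K2 K3 c f] fst_conv snd_conv
      proof (rule nn_integral_cong)
        fix p assume p: "p \<in> space (J (u, z))"
        have uz: "(u, z) \<in> space (spacetime M)" using c by (simp add: space_pair_measure)
        have "(p, t) \<in> space ?N0"
          using p s_finite_kernel_space[OF J uz] by (simp add: space_pair_measure)
        from s_finite_kernel_sets[OF k this] have sets: "sets (k (fst p) (snd p) t) = sets M"
          by (simp add: case_prod_unfold)
        have "f \<in> borel_measurable (k (fst p) (snd p) t)"
          using f by (simp add: measurable_cong_sets[OF sets refl])
        then show "(\<integral>\<^sup>+y. f y \<partial>?K3 (((((s, x), t), u), z), p)) =
            of_bool (s < u \<and> u < t \<and> u < fst p \<and> fst p < t) * (\<integral>\<^sup>+y. f y \<partial>k (fst p) (snd p) t)"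
          by (simp add: nn_integral_density nn_integral_cmult indicator_def)
      qed
    qed
  qed
qed

text \<open>The two sides differ in where the time constraints stand: at each time variable's own
  integral in \<open>perturb\<close>, all together in the innermost integrand here.\<close>

lemma emeasure_perturb_measure:
  assumes l: "s_finite_kernel (spacetime M \<Otimes>\<^sub>M borel) M (\<lambda>((s, x), t). l s x t)"
    and x: "x \<in> space M" and A: "A \<in> sets M"
  shows "emeasure (perturb_measure l ((s, x), t)) A = perturb M \<mu> J k l s x t A"
proof -
  have sets: "sets (perturb_measure l ((s, x), t)) = sets M"
    by (simp add: perturb_measure_def)
  have "emeasure (perturb_measure l ((s, x), t)) A = (\<integral>\<^sup>+y. indicator A y \<partial>perturb_measure l ((s, x), t))"
    using A by (simp add: sets)
  also have "\<dots> = (\<integral>\<^sup>+u. \<integral>\<^sup>+z. \<integral>\<^sup>+p. of_bool (s < u \<and> u < t \<and> u < fst p \<and> fst p < t) *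
            (\<integral>\<^sup>+y. indicator A y \<partial>k (fst p) (snd p) t) \<partial>J (u, z) \<partial>l s x u \<partial>\<mu>)"
    using A by (intro nn_integral_perturb_measure[OF l x]) simp
  also have "\<dots> = perturb M \<mu> J k l s x t A"
    unfolding perturb_def
  proof (rule nn_integral_cong)
    fix u
    have "(\<integral>\<^sup>+z. \<integral>\<^sup>+p. of_bool (s < u \<and> u < t \<and> u < fst p \<and> fst p < t) *
            (\<integral>\<^sup>+y. indicator A y \<partial>k (fst p) (snd p) t) \<partial>J (u, z) \<partial>l s x u) =
      (\<integral>\<^sup>+z. (\<integral>\<^sup>+p\<in>{u<..<t} \<times> space M. emeasure (k (fst p) (snd p) t) A \<partial>J (u, z)) \<partial>l s x u)"
      if u: "s < u" "u < t"
    proof (intro nn_integral_cong)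
      fix z p assume z: "z \<in> space (l s x u)" and p: "p \<in> space (J (u, z))"
      have "((s, x), u) \<in> space (spacetime M \<Otimes>\<^sub>M borel)" using x by (simp add: space_pair_measure)
      from s_finite_kernel_space[OF l this] z have "(u, z) \<in> space (spacetime M)"
        by (simp add: space_pair_measure)
      from s_finite_kernel_space[OF J this] p have p: "(p, t) \<in> space (spacetime M \<Otimes>\<^sub>M borel)"
        by (simp add: space_pair_measure)
      have "A \<in> sets (k (fst p) (snd p) t)"
        using s_finite_kernel_sets[OF k p] A by (simp add: case_prod_unfold)
      then show "of_bool (s < u \<and> u < t \<and> u < fst p \<and> fst p < t) *
            (\<integral>\<^sup>+y. indicator A y \<partial>k (fst p) (snd p) t) =
          emeasure (k (fst p) (snd p) t) A * indicator ({u<..<t} \<times> space M) p"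
        using u p by (auto simp: space_pair_measure split: split_indicator)
    qed
    then show "(\<integral>\<^sup>+z. \<integral>\<^sup>+p. of_bool (s < u \<and> u < t \<and> u < fst p \<and> fst p < t) *
            (\<integral>\<^sup>+y. indicator A y \<partial>k (fst p) (snd p) t) \<partial>J (u, z) \<partial>l s x u) =
      (\<integral>\<^sup>+z. (\<integral>\<^sup>+p\<in>{u<..<t} \<times> space M. emeasure (k (fst p) (snd p) t) A \<partial>J (u, z)) \<partial>l s x u)
        * indicator {s<..<t} u"
      by (cases "s < u \<and> u < t") (auto simp: indicator_def)
  qed
  finally show ?thesis .
qed

section \<open>The terms of the series as s-finite kernels\<close>

abbreviation term_measure :: "nat \<Rightarrow> real \<Rightarrow> 'a \<Rightarrow> real \<Rightarrow> 'a measure" where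
  "term_measure n s x t \<equiv> measure_of (space M) (sets M) (series_term M \<mu> J k n s x t)"

lemma term_measure_0: "x \<in> space M \<Longrightarrow> term_measure 0 s x t = k s x t"
  using s_finite_kernel_sets[OF k, of "((s, x), t)"]
  by (intro measure_of_sets_eq) (simp_all add: space_pair_measure)

text \<open>S-finiteness must be the induction statement: the identification of the next term with a
  \<open>perturb_measure\<close> is available only once the present term is known to be an s-finite
  kernel. It also yields that each k_n is a measure.\<close>

lemma s_finite_kernel_term_measure:
  "s_finite_kernel (spacetime M \<Otimes>\<^sub>M borel) M (\<lambda>((s, x), t). term_measure n s x t)"
proof (induct n)
  case 0
  show ?case
    by (rule s_finite_kernel_cong[OF k]) (auto simp only: term_measure_0 space_pair_measure split: prod.split)
next
  case (Suc n)
  have "term_measure (Suc n) s x t = perturb_measure (term_measure n) ((s, x), t)" if "x \<in> space M" for s x t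
    using emeasure_perturb_measure[OF Suc that]
    by (intro measure_of_sets_eq) (simp_all add: perturb_measure_def)
  then show ?case
    by (intro s_finite_kernel_cong[OF s_finite_kernel_perturb_measure[OF Suc]])
      (auto simp only: space_pair_measure split: prod.split)
qed

lemma term_measure_Suc:
  "x \<in> space M \<Longrightarrow> term_measure (Suc n) s x t = perturb_measure (term_measure n) ((s, x), t)"
  using emeasure_perturb_measure[OF s_finite_kernel_term_measure]
  by (intro measure_of_sets_eq) (simp_all add: perturb_measure_def)

lemma emeasure_term_measure:
  assumes x: "x \<in> space M" and A: "A \<in> sets M"
  shows "emeasure (term_measure n s x t) A = series_term M \<mu> J k n s x t A"
proof (cases n)
  case 0
  then show ?thesis using term_measure_0[OF x] by simp
next
  case (Suc m)
  have "emeasure (term_measure (Suc m) s x t) A = perturb M \<mu> J k (term_measure m) s x t A"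
    unfolding term_measure_Suc[OF x] by (rule emeasure_perturb_measure[OF s_finite_kernel_term_measure x A])
  then show ?thesis by (simp add: Suc)
qed

lemma measurable_emeasure_k:
  assumes A: "A \<in> sets M" and g: "g \<in> measurable N (spacetime M)" and h: "h \<in> borel_measurable N"
  shows "(\<lambda>a. emeasure (k (fst (g a)) (snd (g a)) (h a)) A) \<in> borel_measurable N"
  using measurable_compose[OF measurable_Pair[OF g h] s_finite_kernel_measurable_emeasure[OF k A]]
  by (simp add: case_prod_unfold)

text \<open>The factor J k of k_n J k with the end point fixed, as a function of the place and time
  of departure. It does not depend on n, so each term integrates the same function against its
  predecessor.\<close>

definition jump_integral :: "real \<Rightarrow> 'a set \<Rightarrow> real \<Rightarrow> 'a \<Rightarrow> ennreal" where
  "jump_integral t A v w = (\<integral>\<^sup>+p\<in>{v<..<t} \<times> space M. emeasure (k (fst p) (snd p) t) A \<partial>J (v, w))"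

lemma measurable_jump_integral [measurable]:
  assumes [measurable]: "A \<in> sets M"
  shows "(\<lambda>(v, w). jump_integral t A v w) \<in> borel_measurable (spacetime M)"
proof -
  have [measurable]: "(\<lambda>d. emeasure (k (fst (snd d)) (snd (snd d)) t) A) \<in> borel_measurable (spacetime M \<Otimes>\<^sub>M spacetime M)"
    by (rule measurable_emeasure_k) auto
  \<comment> \<open>The domain of integration moves with the parameter \<open>q\<close>; its
    indicator becomes a jointly measurable factor of the integrand.\<close>
  have "(\<lambda>q. jump_integral t A (fst q) (snd q)) =
      (\<lambda>q. \<integral>\<^sup>+p. emeasure (k (fst p) (snd p) t) A *
        (of_bool (fst q < fst p \<and> fst p < t) * indicator (space M) (snd p)) \<partial>J q)"
    unfolding jump_integral_def prod.collapse
    by (intro ext nn_integral_cong arg_cong2[where f = "(*)"]) (auto split: split_indicator)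
  also have "\<dots> \<in> borel_measurable (spacetime M)"
    by (rule s_finite_kernel_measurable_nn_integral_pullback[OF J, where g = "\<lambda>q. q"])
      (simp_all add: case_prod_unfold)
  finally show ?thesis by (simp add: case_prod_unfold)
qed

lemma series_term_Suc:
  "series_term M \<mu> J k (Suc n) s x t A =
    (\<integral>\<^sup>+u\<in>{s<..<t}. (\<integral>\<^sup>+z. jump_integral t A u z \<partial>term_measure n s x u) \<partial>\<mu>)"
  by (simp add: perturb_def jump_integral_def)

lemma series_term_1:
  assumes "x \<in> space M"
  shows "series_term M \<mu> J k (Suc 0) s x t A =
    (\<integral>\<^sup>+u\<in>{s<..<t}. (\<integral>\<^sup>+z. jump_integral t A u z \<partial>k s x u) \<partial>\<mu>)"
  unfolding series_term_Suc term_measure_0[OF assms] ..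

text \<open>Associativity \<open>k\<^sub>n J k J k = k\<^sub>n J (k J k)\<close>: the integration over the second intermediate time \<open>v\<close>
  is moved innermost, past \<open>u\<close>, \<open>k\<^sub>n\<close> and \<open>J\<close>.\<close>

lemma series_term_Suc_Suc:
  assumes x: "x \<in> space M" and A [measurable]: "A \<in> sets M"
  shows "series_term M \<mu> J k (Suc (Suc n)) s x t A =
    (\<integral>\<^sup>+u\<in>{s<..<t}. (\<integral>\<^sup>+z. (\<integral>\<^sup>+p\<in>{u<..<t} \<times> space M.
        series_term M \<mu> J k (Suc 0) (fst p) (snd p) t A \<partial>J (u, z)) \<partial>term_measure n s x u) \<partial>\<mu>)"
proof -
  \<comment> \<open>Here u and v are the departure times of the last two jumps and p is where the
    earlier one lands. With all constraints inside the integrand, changing the order of integration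
    never changes limits.\<close>
  define \<Phi> where "\<Phi> u z p v = of_bool (s < u \<and> u < v \<and> v < t \<and> u < fst p \<and> fst p < v) *
    (\<integral>\<^sup>+w. jump_integral t A v w \<partial>k (fst p) (snd p) v)" for u v :: real and z :: 'a and p
  have l: "s_finite_kernel borel M (\<lambda>u. term_measure n s x u)"
    using s_finite_kernel_pullback[OF s_finite_kernel_term_measure[of n], of "\<lambda>u. ((s, x), u)" borel] x
    by simp
  let ?N = "borel \<Otimes>\<^sub>M borel :: (real \<times> real) measure"
  have m3: "(\<lambda>(((u, v), z), p). \<Phi> u z p v) \<in> borel_measurable ((?N \<Otimes>\<^sub>M M) \<Otimes>\<^sub>M spacetime M)"
  proof -
    have "(\<lambda>d. \<integral>\<^sup>+w. jump_integral t A (snd (fst (fst d))) w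
          \<partial>((\<lambda>((s, x), t). k s x t) (snd d, snd (fst (fst d)))))
        \<in> borel_measurable ((?N \<Otimes>\<^sub>M M) \<Otimes>\<^sub>M spacetime M)"
      by (rule s_finite_kernel_measurable_nn_integral_pullback[OF k]) measurable
    then show ?thesis
      unfolding \<Phi>_def by (simp add: case_prod_unfold)
  qed
  have m2: "(\<lambda>((u, v), z). \<integral>\<^sup>+p. \<Phi> u z p v \<partial>J (u, z)) \<in> borel_measurable (?N \<Otimes>\<^sub>M M)"
    using s_finite_kernel_measurable_nn_integral_pullback[OF J, where g = "\<lambda>b. (fst (fst b), snd b)", of "?N \<Otimes>\<^sub>M M"
        "\<lambda>b p. \<Phi> (fst (fst b)) (snd b) p (snd (fst b))"] m3
    by (simp add: case_prod_unfold)
  have m1: "(\<lambda>(u, v). \<integral>\<^sup>+z. \<integral>\<^sup>+p. \<Phi> u z p v \<partial>J (u, z) \<partial>term_measure n s x u) \<in> borel_measurable ?N"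
    using s_finite_kernel_measurable_nn_integral_pullback[OF l, where g = fst, of ?N
        "\<lambda>a z. \<integral>\<^sup>+p. \<Phi> (fst a) z p (snd a) \<partial>J (fst a, z)"] m2
    by (simp add: case_prod_unfold)
  interpret \<mu>: sigma_finite_measure \<mu> by (rule \<mu>)
  interpret \<mu>\<mu>: pair_sigma_finite \<mu> \<mu> ..
  have "series_term M \<mu> J k (Suc (Suc n)) s x t A =
      (\<integral>\<^sup>+v. \<integral>\<^sup>+u. \<integral>\<^sup>+z. \<integral>\<^sup>+p. \<Phi> u z p v \<partial>J (u, z) \<partial>term_measure n s x u \<partial>\<mu> \<partial>\<mu>)"
    unfolding series_term_Suc[of "Suc n"]
  proof (rule nn_integral_cong)
    fix v
    have G: "(\<lambda>w. jump_integral t A v w) \<in> borel_measurable M"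
      using measurable_Pair2[OF measurable_jump_integral[OF A]] by simp
    have "(\<integral>\<^sup>+z. jump_integral t A v z \<partial>term_measure (Suc n) s x v) * indicator {s<..<t} v =
      (\<integral>\<^sup>+u. \<integral>\<^sup>+z. \<integral>\<^sup>+p. of_bool (s < u \<and> u < v \<and> u < fst p \<and> fst p < v) *
            (\<integral>\<^sup>+y. jump_integral t A v y \<partial>k (fst p) (snd p) v) \<partial>J (u, z) \<partial>term_measure n s x u \<partial>\<mu>)
      * indicator {s<..<t} v"
      unfolding term_measure_Suc[OF x] nn_integral_perturb_measure[OF s_finite_kernel_term_measure x G] ..
    also have "\<dots> = (\<integral>\<^sup>+u. \<integral>\<^sup>+z. \<integral>\<^sup>+p. \<Phi> u z p v \<partial>J (u, z) \<partial>term_measure n s x u \<partial>\<mu>)"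
    proof (cases "s < v \<and> v < t")
      case True
      then show ?thesis by (simp add: \<Phi>_def)
    next
      case False
      then have "\<Phi> u z p v = 0" for u z p by (auto simp: \<Phi>_def)
      with False show ?thesis by (simp add: indicator_def)
    qed
    finally show "(\<integral>\<^sup>+z. jump_integral t A v z \<partial>term_measure (Suc n) s x v) * indicator {s<..<t} v =
      (\<integral>\<^sup>+u. \<integral>\<^sup>+z. \<integral>\<^sup>+p. \<Phi> u z p v \<partial>J (u, z) \<partial>term_measure n s x u \<partial>\<mu>)" .
  qed
  \<comment> \<open>This exchange involves \<mu> twice and is the classical one; the next two
    exchange \<mu> with k_n and with J.\<close>
  also have "\<dots> = (\<integral>\<^sup>+u. \<integral>\<^sup>+v. \<integral>\<^sup>+z. \<integral>\<^sup>+p. \<Phi> u z p v \<partial>J (u, z) \<partial>term_measure n s x u \<partial>\<mu> \<partial>\<mu>)"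
    using m1 by (intro \<mu>\<mu>.Fubini')
      (simp add: measurable_cong_sets[OF sets_pair_measure_cong[OF sets_\<mu> sets_\<mu>] refl])
  also have "\<dots> = (\<integral>\<^sup>+u. \<integral>\<^sup>+z. \<integral>\<^sup>+v. \<integral>\<^sup>+p. \<Phi> u z p v \<partial>J (u, z) \<partial>\<mu> \<partial>term_measure n s x u \<partial>\<mu>)"
  proof (rule nn_integral_cong)
    fix u
    have "(\<lambda>(z, v). ((u, v), z)) \<in> measurable (M \<Otimes>\<^sub>M \<mu>) (?N \<Otimes>\<^sub>M M)" by measurable
    from measurable_compose[OF this m2]
    have "(\<lambda>(z, v). \<integral>\<^sup>+p. \<Phi> u z p v \<partial>J (u, z)) \<in> borel_measurable (M \<Otimes>\<^sub>M \<mu>)"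
      by (simp add: case_prod_unfold)
    then show "(\<integral>\<^sup>+v. \<integral>\<^sup>+z. \<integral>\<^sup>+p. \<Phi> u z p v \<partial>J (u, z) \<partial>term_measure n s x u \<partial>\<mu>) =
        (\<integral>\<^sup>+z. \<integral>\<^sup>+v. \<integral>\<^sup>+p. \<Phi> u z p v \<partial>J (u, z) \<partial>\<mu> \<partial>term_measure n s x u)"
      using s_finite_kernel_Tonelli[OF l _ \<mu>] by simp
  qed
  also have "\<dots> = (\<integral>\<^sup>+u. \<integral>\<^sup>+z. \<integral>\<^sup>+p. \<integral>\<^sup>+v. \<Phi> u z p v \<partial>\<mu> \<partial>J (u, z) \<partial>term_measure n s x u \<partial>\<mu>)"
  proof (intro nn_integral_cong)
    fix u z assume "z \<in> space (term_measure n s x u)"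
    then have z [measurable]: "z \<in> space M" using s_finite_kernel_space[OF l, of u] by simp
    have "(\<lambda>(p, v). (((u, v), z), p)) \<in> measurable (spacetime M \<Otimes>\<^sub>M \<mu>) ((?N \<Otimes>\<^sub>M M) \<Otimes>\<^sub>M spacetime M)"
      by measurable
    from measurable_compose[OF this m3]
    have "(\<lambda>(p, v). \<Phi> u z p v) \<in> borel_measurable (spacetime M \<Otimes>\<^sub>M \<mu>)"
      by (simp add: case_prod_unfold)
    then show "(\<integral>\<^sup>+v. \<integral>\<^sup>+p. \<Phi> u z p v \<partial>J (u, z) \<partial>\<mu>) = (\<integral>\<^sup>+p. \<integral>\<^sup>+v. \<Phi> u z p v \<partial>\<mu> \<partial>J (u, z))"
      using z s_finite_kernel_Tonelli[OF J _ \<mu>, of "(u, z)"] by (simp add: space_pair_measure)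
  qed
  also have "\<dots> = (\<integral>\<^sup>+u\<in>{s<..<t}. (\<integral>\<^sup>+z. (\<integral>\<^sup>+p\<in>{u<..<t} \<times> space M.
        series_term M \<mu> J k (Suc 0) (fst p) (snd p) t A \<partial>J (u, z)) \<partial>term_measure n s x u) \<partial>\<mu>)"
  proof (rule nn_integral_cong)
    fix u
    show "(\<integral>\<^sup>+z. \<integral>\<^sup>+p. \<integral>\<^sup>+v. \<Phi> u z p v \<partial>\<mu> \<partial>J (u, z) \<partial>term_measure n s x u) =
      (\<integral>\<^sup>+z. (\<integral>\<^sup>+p\<in>{u<..<t} \<times> space M.
        series_term M \<mu> J k (Suc 0) (fst p) (snd p) t A \<partial>J (u, z)) \<partial>term_measure n s x u) * indicator {s<..<t} u"
    proof (cases "s < u \<and> u < t")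
      case False
      then have "\<Phi> u z p v = 0" for z p v by (auto simp: \<Phi>_def)
      with False show ?thesis by (simp add: indicator_def)
    next
      case True
      have "(\<integral>\<^sup>+z. \<integral>\<^sup>+p. \<integral>\<^sup>+v. \<Phi> u z p v \<partial>\<mu> \<partial>J (u, z) \<partial>term_measure n s x u) =
      (\<integral>\<^sup>+z. (\<integral>\<^sup>+p\<in>{u<..<t} \<times> space M.
        series_term M \<mu> J k (Suc 0) (fst p) (snd p) t A \<partial>J (u, z)) \<partial>term_measure n s x u)"
      proof (intro nn_integral_cong)
        fix z p assume z: "z \<in> space (term_measure n s x u)" and p: "p \<in> space (J (u, z))"
        have "(u, z) \<in> space (spacetime M)"
          using z s_finite_kernel_space[OF l, of u] by (simp add: space_pair_measure)
        with p s_finite_kernel_space[OF J] have p: "snd p \<in> space M"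
          by (auto simp: space_pair_measure)
        show "(\<integral>\<^sup>+v. \<Phi> u z p v \<partial>\<mu>) =
          series_term M \<mu> J k (Suc 0) (fst p) (snd p) t A * indicator ({u<..<t} \<times> space M) p"
        proof (cases "u < fst p \<and> fst p < t")
          case False
          then have "\<Phi> u z p v = 0" for v by (auto simp: \<Phi>_def)
          with False show ?thesis by (auto simp: indicator_def)
        next
          case p_between: True
          \<comment> \<open>The constraints left on v are those of k_1 started at p; u < v follows
            from u < \<open>fst p\<close> < v.\<close>
          have "(\<integral>\<^sup>+v. \<Phi> u z p v \<partial>\<mu>) =
              (\<integral>\<^sup>+v\<in>{fst p<..<t}. (\<integral>\<^sup>+w. jump_integral t A v w \<partial>k (fst p) (snd p) v) \<partial>\<mu>)"
            using True p_between
            by (intro nn_integral_cong) (auto simp: \<Phi>_def indicator_def)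
          also have "\<dots> = series_term M \<mu> J k (Suc 0) (fst p) (snd p) t A"
            by (rule series_term_1[OF p, symmetric])
          finally show ?thesis
            using p_between p by (cases p) (simp add: indicator_def)
        qed
      qed
      with True show ?thesis by simp
    qed
  qed
  finally show ?thesis .
qed

end

section \<open>The bound on the ratio of consecutive terms\<close>

declare series_term.simps(2) [simp del]

context kernel_perturbation
begin

lemma perturb_eq_jump_integral:
  "perturb M \<mu> J k l s x t A = (\<integral>\<^sup>+u\<in>{s<..<t}. (\<integral>\<^sup>+z. jump_integral t A u z \<partial>l s x u) \<partial>\<mu>)"
  unfolding perturb_def jump_integral_def ..

text \<open>All terms start from the same (s,x), but the hypothesis is needed at intermediate end
  times u and for all measurable sets; hence the induction generalises \<open>t\<close> and
  \<open>A\<close> while \<open>x\<close> stays fixed.\<close>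

lemma series_term_Suc_le:
  assumes \<eta>: "0 \<le> \<eta>" and Q_nonneg: "\<And>u v. 0 \<le> Q u v" and Q: "super_additive Q"
    and bound: "\<And>s x t A. x \<in> space M \<Longrightarrow> A \<in> sets M \<Longrightarrow>
      perturb M \<mu> J k k s x t A \<le> ennreal (\<eta> + Q s t) * emeasure (k s x t) A"
    and x: "x \<in> space M" and "A \<in> sets M"
  shows "series_term M \<mu> J k (Suc n) s x t A
    \<le> ennreal (\<eta> + Q s t / real (Suc n)) * series_term M \<mu> J k n s x t A"
  using \<open>A \<in> sets M\<close>
proof (induct n arbitrary: s t A)
  case 0
  have "series_term M \<mu> J k (Suc 0) s x t A = perturb M \<mu> J k k s x t A"
    unfolding series_term_1[OF x] perturb_eq_jump_integral ..
  with bound[OF x 0] show ?case by simp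
next
  case (Suc n)
  note A [measurable] = \<open>A \<in> sets M\<close>
  let ?T = "\<lambda>n s x t. series_term M \<mu> J k n s x t A"
  \<comment> \<open>The integrand of k_{n+1} as a function of u, and the common function to which
    both estimates of k_{n+2} are reduced.\<close>
  define m where "m u = (\<integral>\<^sup>+z. jump_integral t A u z \<partial>term_measure n s x u)" for u
  have l: "s_finite_kernel borel M (\<lambda>u. term_measure i s x u)" for i
    using s_finite_kernel_pullback[OF s_finite_kernel_term_measure[of i], of "\<lambda>u. ((s, x), u)" borel] x
    by simp
  have [measurable]: "m \<in> borel_measurable borel"
    using s_finite_kernel_measurable_nn_integral[OF l measurable_jump_integral[OF A]]
    by (simp add: m_def[abs_def])
  have G: "(\<lambda>z. jump_integral t A u z) \<in> borel_measurable (term_measure i s x u)" for u i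
  proof -
    have sets: "sets (term_measure i s x u) = sets M" by simp
    have "(\<lambda>z. (\<lambda>(v, w). jump_integral t A v w) (u, z)) \<in> borel_measurable M"
      by (rule measurable_Pair2[OF measurable_jump_integral[OF A]]) simp
    then show ?thesis unfolding measurable_cong_sets[OF sets refl] by simp
  qed
  \<comment> \<open>\<open>Q\<close> itself need not be measurable, but super-additivity makes \<open>Q s\<close> monotone on \<open>{s<..}\<close>.\<close>
  define q where "q u = (if s < u then Q s u else 0)" for u
  have "mono q"
  proof
    fix u v :: real assume "u \<le> v"
    show "q u \<le> q v"
    proof (cases "s < u \<and> u < v")
      case True
      then have "Q s u + Q u v \<le> Q s v" using Q unfolding super_additive_def by blast
      with True Q_nonneg[of u v] show ?thesis by (simp add: q_def)
    next
      case False
      with \<open>u \<le> v\<close> Q_nonneg[of s v] show ?thesis by (auto simp: q_def)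
    qed
  qed
  then have [measurable]: "q \<in> borel_measurable borel" by (rule borel_measurable_mono)
  have q_nonneg: "0 \<le> q u" for u by (simp add: q_def Q_nonneg)
  \<comment> \<open>Q(s,t) is split at u, then Q(u,t) at r, and Q(u,r) is dropped. The resulting
    bound on Q(r,t) no longer involves the landing time r.\<close>
  have q_le: "q u + Q r t \<le> Q s t" if "s < u" "u < r" "r < t" for u r
  proof -
    have "Q u r + Q r t \<le> Q u t" "Q s u + Q u t \<le> Q s t"
      using Q that unfolding super_additive_def by auto
    with Q_nonneg[of u r] that show ?thesis by (simp add: q_def)
  qed
  have T: "?T (Suc n) s x t = (\<integral>\<^sup>+u\<in>{s<..<t}. m u \<partial>\<mu>)"
    unfolding series_term_Suc m_def ..
  have "?T (Suc (Suc n)) s x t \<le> (\<integral>\<^sup>+u\<in>{s<..<t}. (ennreal (\<eta> + q u / real (Suc n)) * m u) \<partial>\<mu>)"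
    unfolding series_term_Suc[of "Suc n"]
  proof (intro nn_integral_mono)
    fix u
    have "(\<integral>\<^sup>+z. jump_integral t A u z \<partial>term_measure (Suc n) s x u) \<le> ennreal (\<eta> + q u / real (Suc n)) * m u"
      if "s < u"
      unfolding m_def
    \<comment> \<open>The hypothesis enters at end time u and for every \<open>B\<close>, not at the
      set \<open>A\<close> of the goal, which is hidden in the integrand.\<close>
    proof (rule nn_integral_le_of_emeasure_le[OF _ _ G])
      fix B assume "B \<in> sets (term_measure n s x u)"
      then have B: "B \<in> sets M" by simp
      show "emeasure (term_measure (Suc n) s x u) B
          \<le> ennreal (\<eta> + q u / real (Suc n)) * emeasure (term_measure n s x u) B"
        unfolding emeasure_term_measure[OF x B] using Suc(1)[OF B, of s u] that by (simp add: q_def)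
    qed simp
    then show "(\<integral>\<^sup>+z. jump_integral t A u z \<partial>term_measure (Suc n) s x u) * indicator {s<..<t} u
        \<le> ennreal (\<eta> + q u / real (Suc n)) * m u * indicator {s<..<t} u"
      by (simp split: split_indicator)
  qed
  then have "ennreal (real (Suc n)) * ?T (Suc (Suc n)) s x t
      \<le> ennreal (real (Suc n)) * (\<integral>\<^sup>+u\<in>{s<..<t}. (ennreal (\<eta> + q u / real (Suc n)) * m u) \<partial>\<mu>)"
    by (rule mult_left_mono) simp
  also have "\<dots> = (\<integral>\<^sup>+u\<in>{s<..<t}. (ennreal (real (Suc n)) * (ennreal (\<eta> + q u / real (Suc n)) * m u)) \<partial>\<mu>)"
    by (subst nn_integral_cmult[symmetric]) (simp_all add: mult.assoc)
  also have "\<dots> = (\<integral>\<^sup>+u\<in>{s<..<t}. (ennreal (real (Suc n) * \<eta> + q u) * m u) \<partial>\<mu>)"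
  proof -
    have "ennreal (real (Suc n)) * ennreal (\<eta> + q u / real (Suc n)) = ennreal (real (Suc n) * \<eta> + q u)" for u
      using \<eta> q_nonneg[of u] by (subst ennreal_mult[symmetric]) (auto simp: distrib_left simp del: of_nat_Suc)
    then show ?thesis by (simp add: mult.assoc[symmetric] del: of_nat_Suc)
  qed
  finally have le1: "ennreal (real (Suc n)) * ?T (Suc (Suc n)) s x t \<le> \<dots>" .
  \<comment> \<open>The other bracketing: the assumption bounds k_1 from the landing point, and the
    factor is constant in z and p.\<close>
  have le2: "?T (Suc (Suc n)) s x t \<le> (\<integral>\<^sup>+u\<in>{s<..<t}. (ennreal (\<eta> + (Q s t - q u)) * m u) \<partial>\<mu>)"
    unfolding series_term_Suc_Suc[OF x A]
  proof (rule nn_integral_mono)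
    fix u
    have "(\<integral>\<^sup>+z. (\<integral>\<^sup>+p\<in>{u<..<t} \<times> space M. ?T (Suc 0) (fst p) (snd p) t \<partial>J (u, z)) \<partial>term_measure n s x u)
        \<le> ennreal (\<eta> + (Q s t - q u)) * m u" if u: "s < u" "u < t"
    proof -
      have "(\<integral>\<^sup>+z. (\<integral>\<^sup>+p\<in>{u<..<t} \<times> space M. ?T (Suc 0) (fst p) (snd p) t \<partial>J (u, z)) \<partial>term_measure n s x u)
          \<le> (\<integral>\<^sup>+z. ennreal (\<eta> + (Q s t - q u)) * jump_integral t A u z \<partial>term_measure n s x u)"
      proof (rule nn_integral_mono)
        fix z assume "z \<in> space (term_measure n s x u)"
        then have uz: "(u, z) \<in> space (spacetime M)"
          by (simp add: space_pair_measure)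
        have sets: "sets (J (u, z)) = sets (spacetime M)" by (rule s_finite_kernel_sets[OF J uz])
        have "(\<integral>\<^sup>+p\<in>{u<..<t} \<times> space M. ?T (Suc 0) (fst p) (snd p) t \<partial>J (u, z))
            \<le> (\<integral>\<^sup>+p. ennreal (\<eta> + (Q s t - q u)) *
                (emeasure (k (fst p) (snd p) t) A * indicator ({u<..<t} \<times> space M) p) \<partial>J (u, z))"
        proof (rule nn_integral_mono)
          fix p assume "p \<in> space (J (u, z))"
          then have p: "snd p \<in> space M"
            unfolding sets_eq_imp_space_eq[OF sets] by (simp add: space_pair_measure mem_Times_iff)
          have "?T (Suc 0) (fst p) (snd p) t \<le> ennreal (\<eta> + Q (fst p) t) * emeasure (k (fst p) (snd p) t) A"
            using bound[OF p A, of "fst p" t] unfolding series_term_1[OF p] perturb_eq_jump_integral .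
          also have "\<dots> \<le> ennreal (\<eta> + (Q s t - q u)) * emeasure (k (fst p) (snd p) t) A"
            if "u < fst p" "fst p < t"
            using q_le[OF u(1) that] by (intro mult_right_mono ennreal_leI) simp_all
          finally show "?T (Suc 0) (fst p) (snd p) t * indicator ({u<..<t} \<times> space M) p
              \<le> ennreal (\<eta> + (Q s t - q u)) *
                (emeasure (k (fst p) (snd p) t) A * indicator ({u<..<t} \<times> space M) p)"
            by (auto split: split_indicator)
        qed
        also have "\<dots> = ennreal (\<eta> + (Q s t - q u)) * jump_integral t A u z"
          unfolding jump_integral_def
        proof (rule nn_integral_cmult)
          have [measurable]: "(\<lambda>p. emeasure (k (fst p) (snd p) t) A) \<in> borel_measurable (spacetime M)"
            using A by (intro measurable_emeasure_k) auto
          show "(\<lambda>p. emeasure (k (fst p) (snd p) t) A * indicator ({u<..<t} \<times> space M) p)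
              \<in> borel_measurable (J (u, z))"
            unfolding measurable_cong_sets[OF sets refl] by measurable
        qed
        finally show "(\<integral>\<^sup>+p\<in>{u<..<t} \<times> space M. ?T (Suc 0) (fst p) (snd p) t \<partial>J (u, z))
            \<le> ennreal (\<eta> + (Q s t - q u)) * jump_integral t A u z" .
      qed
      also have "\<dots> = ennreal (\<eta> + (Q s t - q u)) * m u"
        unfolding m_def by (rule nn_integral_cmult[OF G])
      finally show ?thesis .
    qed
    then show "(\<integral>\<^sup>+z. (\<integral>\<^sup>+p\<in>{u<..<t} \<times> space M. ?T (Suc 0) (fst p) (snd p) t \<partial>J (u, z)) \<partial>term_measure n s x u)
          * indicator {s<..<t} u
        \<le> ennreal (\<eta> + (Q s t - q u)) * m u * indicator {s<..<t} u"
      by (simp split: split_indicator)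
  qed
  let ?c = "real (Suc (Suc n)) * \<eta> + Q s t"
  have "ennreal (real (Suc (Suc n))) * ?T (Suc (Suc n)) s x t
      = ennreal (real (Suc n)) * ?T (Suc (Suc n)) s x t + ?T (Suc (Suc n)) s x t"
  proof -
    have "real (Suc (Suc n)) = real (Suc n) + 1" by simp
    moreover have "ennreal (real (Suc n) + 1) = ennreal (real (Suc n)) + ennreal 1"
      by (rule ennreal_plus) simp_all
    ultimately show ?thesis by (simp only: ennreal_1 distrib_right mult_1_left)
  qed
  also have "\<dots> \<le> (\<integral>\<^sup>+u\<in>{s<..<t}. (ennreal (real (Suc n) * \<eta> + q u) * m u) \<partial>\<mu>)
      + (\<integral>\<^sup>+u\<in>{s<..<t}. (ennreal (\<eta> + (Q s t - q u)) * m u) \<partial>\<mu>)"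
    by (intro add_mono le1 le2)
  also have "\<dots> = (\<integral>\<^sup>+u. ennreal (real (Suc n) * \<eta> + q u) * m u * indicator {s<..<t} u +
      ennreal (\<eta> + (Q s t - q u)) * m u * indicator {s<..<t} u \<partial>\<mu>)"
    by (rule nn_integral_add[symmetric]) measurable
  also have "\<dots> = (\<integral>\<^sup>+u. ennreal ?c * (m u * indicator {s<..<t} u) \<partial>\<mu>)"
  proof (rule nn_integral_cong)
    fix u
    have "ennreal (real (Suc n) * \<eta> + q u) + ennreal (\<eta> + (Q s t - q u)) = ennreal ?c" if u: "s < u" "u < t"
    proof -
      \<comment> \<open>\<open>ennreal\<close> truncates negative numbers, so the factors add up
        exactly only if Q(s,t) - q(u) is nonnegative. The midpoint is just some time strictly
        between u and t.\<close>
      have "q u \<le> Q s t"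
        using q_le[of u "(u + t) / 2"] u Q_nonneg[of "(u + t) / 2" t] by simp
      then show ?thesis
        using \<eta> q_nonneg[of u] by (subst ennreal_plus[symmetric]) (auto simp: algebra_simps)
    qed
    then show "ennreal (real (Suc n) * \<eta> + q u) * m u * indicator {s<..<t} u +
        ennreal (\<eta> + (Q s t - q u)) * m u * indicator {s<..<t} u = ennreal ?c * (m u * indicator {s<..<t} u)"
      by (simp add: distrib_right[symmetric] del: of_nat_Suc split: split_indicator)
  qed
  also have "\<dots> = ennreal ?c * ?T (Suc n) s x t"
    unfolding T by (rule nn_integral_cmult) measurable
  \<comment> \<open>Multiplying by the inverse of n + 2 instead of cancelling remains valid for
    infinite values.\<close>
  finally have "ennreal (1 / real (Suc (Suc n))) * (ennreal (real (Suc (Suc n))) * ?T (Suc (Suc n)) s x t)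
      \<le> ennreal (1 / real (Suc (Suc n))) * (ennreal ?c * ?T (Suc n) s x t)"
    by (rule mult_left_mono) simp
  moreover have "ennreal (1 / real (Suc (Suc n))) * ennreal (real (Suc (Suc n))) = 1"
    by (subst ennreal_mult[symmetric]) (auto simp del: of_nat_Suc)
  moreover have "ennreal (1 / real (Suc (Suc n))) * ennreal ?c = ennreal (\<eta> + Q s t / real (Suc (Suc n)))"
    using \<eta> Q_nonneg[of s t]
    by (subst ennreal_mult[symmetric]) (auto simp: add_divide_distrib simp del: of_nat_Suc)
  ultimately show ?case by (simp only: mult.assoc[symmetric] mult_1_left)
qed

end

section \<open>Summing the products\<close>

text \<open>With a = -(1 + q/\<eta>) one has \<eta> + q/l = (-\<eta>)(a - (l - 1))/l, so the
  products are the terms of the binomial series for the a-th power of 1 - \<eta>. This is the origin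
  of the exponent 1 + q/\<eta>, and \<eta> < 1 places -\<eta> inside the radius of
  convergence.\<close>

lemma sums_prod_shifted_ratio:
  fixes \<eta> q :: real
  assumes "0 < \<eta>" "\<eta> < 1"
  shows "(\<lambda>n. \<Prod>l=1..n. \<eta> + q / real l) sums ((1 / (1 - \<eta>)) powr (1 + q / \<eta>))"
proof -
  let ?a = "- (1 + q / \<eta>)"
  have "(\<Prod>l=1..n. \<eta> + q / real l) = (?a gchoose n) * (- \<eta>) ^ n" for n
  proof (induct n)
    case (Suc n)
    have "(?a gchoose Suc n) * real (Suc n) = (?a - real n) * (?a gchoose n)"
      using gbinomial_absorption'[of "Suc n" ?a] gbinomial_mult_1[of ?a n]
      by (simp add: algebra_simps)
    then have gbinomial: "?a gchoose Suc n = (?a gchoose n) * ((?a - real n) / real (Suc n))"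
      by (simp add: field_simps)
    have "(?a - real n) * (- \<eta>) = \<eta> * real (Suc n) + q"
      using assms by (simp add: field_simps)
    then have ratio: "(?a - real n) / real (Suc n) * (- \<eta>) = \<eta> + q / real (Suc n)"
      unfolding times_divide_eq_left by (simp only:) (simp add: add_divide_distrib del: of_nat_Suc)
    have "(\<Prod>l=1..Suc n. \<eta> + q / real l) = (\<Prod>l=1..n. \<eta> + q / real l) * (\<eta> + q / real (Suc n))"
      by simp
    also have "\<dots> = (?a gchoose n) * (- \<eta>) ^ n * ((?a - real n) / real (Suc n) * (- \<eta>))"
      unfolding Suc ratio ..
    also have "\<dots> = (?a gchoose Suc n) * (- \<eta>) ^ Suc n"
      unfolding gbinomial by (simp only: power_Suc mult_ac)
    finally show ?case .
  qed simp
  moreover have "(\<lambda>n. (- (1 + q / \<eta>) gchoose n) * (- \<eta>) ^ n) sums (1 + - \<eta>) powr (- (1 + q / \<eta>))"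
    using assms by (intro gen_binomial_real) simp
  moreover have "(1 + - \<eta>) powr (- (1 + q / \<eta>)) = (1 / (1 - \<eta>)) powr (1 + q / \<eta>)"
    unfolding powr_minus_divide using assms by (simp add: powr_divide)
  ultimately show ?thesis by simp
qed

lemma sums_prod_ratio: "(\<lambda>n. \<Prod>l=1..n. q / real l) sums exp (q :: real)"
proof -
  have "(\<Prod>l=1..n. q / real l) = q ^ n / fact n" for n
    by (induct n) (simp_all add: mult_ac)
  then show ?thesis using exp_converges[of q] by (simp add: divide_inverse_commute)
qed

theorem theorem2p3:
  fixes M :: "'a measure"
    and \<mu> :: "real measure"
    and J :: "real \<times> 'a \<Rightarrow> (real \<times> 'a) measure"
    and k :: "real \<Rightarrow> 'a \<Rightarrow> real \<Rightarrow> 'a measure"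
    and \<eta> :: real
    and Q :: "real \<Rightarrow> real \<Rightarrow> real"
  assumes "forward_kernel M J"
    and "0 \<le> \<eta>"
    and "\<And>u v. 0 \<le> Q u v"
    and "super_additive Q"
    and "sets \<mu> = sets borel"
    and "sigma_finite_measure \<mu>"
    and "non_atomic \<mu>"
    and "\<And>s x t. x \<in> space M \<Longrightarrow> sets (k s x t) = sets M"
    and "forward_density M \<mu> k"
    and "\<And>t A. A \<in> sets M \<Longrightarrow> (\<lambda>(s, x). emeasure (k s x t) A) \<in> borel_measurable (spacetime M)"
    and "tonelli_regular M J k"
    and "\<And>s x t A. x \<in> space M \<Longrightarrow> A \<in> sets M \<Longrightarrow>
           perturb M \<mu> J k k s x t A \<le> ennreal (\<eta> + Q s t) * emeasure (k s x t) A"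
  shows "(\<forall>n\<ge>1. \<forall>s. \<forall>x\<in>space M. \<forall>t.
            measure_le M (series_term M \<mu> J k n s x t)
              (\<lambda>A. series_term M \<mu> J k (n - 1) s x t A * ennreal (\<eta> + Q s t / real n)) \<and>
            measure_le M
              (\<lambda>A. series_term M \<mu> J k (n - 1) s x t A * ennreal (\<eta> + Q s t / real n))
              (\<lambda>A. emeasure (k s x t) A * ennreal (\<Prod>l=1..n. \<eta> + Q s t / real l)))
       \<and> (0 < \<eta> \<and> \<eta> < 1 \<longrightarrow> (\<forall>s. \<forall>x\<in>space M. \<forall>t.
            measure_le M (series_sum M \<mu> J k s x t)
              (\<lambda>A. emeasure (k s x t) A * ennreal ((1 / (1 - \<eta>)) powr (1 + Q s t / \<eta>)))))
       \<and> (\<eta> = 0 \<longrightarrow> (\<forall>s. \<forall>x\<in>space M. \<forall>t.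
            measure_le M (series_sum M \<mu> J k s x t)
              (\<lambda>A. emeasure (k s x t) A * ennreal (exp (Q s t)))))"
proof -
  interpret kernel_perturbation M \<mu> J k
    using assms(5,6,11) by (simp add: kernel_perturbation_def tonelli_regular_def)
  let ?T = "series_term M \<mu> J k"
  let ?P = "\<lambda>n s t. \<Prod>l=1..n. \<eta> + Q s t / real l"
  have factor_nonneg: "0 \<le> \<eta> + Q s t / real l" for s t l
    using assms(2,3) by simp
  have step: "?T (Suc n) s x t A \<le> ?T n s x t A * ennreal (\<eta> + Q s t / real (Suc n))"
    if "x \<in> space M" "A \<in> sets M" for n s x t A
    unfolding mult.commute[of _ "ennreal (\<eta> + Q s t / real (Suc n))"]
    by (rule series_term_Suc_le[OF assms(2-4,12) that])
  have prod_Suc: "c * ennreal (?P n s t) * ennreal (\<eta> + Q s t / real (Suc n)) = c * ennreal (?P (Suc n) s t)" for c n s t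
  proof -
    have "ennreal (?P (Suc n) s t) = ennreal (?P n s t * (\<eta> + Q s t / real (Suc n)))" by simp
    also have "\<dots> = ennreal (?P n s t) * ennreal (\<eta> + Q s t / real (Suc n))"
      using factor_nonneg by (intro ennreal_mult prod_nonneg) (auto simp del: of_nat_Suc)
    finally show ?thesis by (simp only: mult.assoc)
  qed
  have prod_bound: "?T n s x t A \<le> emeasure (k s x t) A * ennreal (?P n s t)"
    if "x \<in> space M" "A \<in> sets M" for n s x t A
  proof (induct n)
    case (Suc n)
    have "?T (Suc n) s x t A \<le> ?T n s x t A * ennreal (\<eta> + Q s t / real (Suc n))"
      by (rule step[OF that])
    also have "\<dots> \<le> emeasure (k s x t) A * ennreal (?P n s t) * ennreal (\<eta> + Q s t / real (Suc n))"
      by (rule mult_right_mono[OF Suc]) simp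
    also have "\<dots> = emeasure (k s x t) A * ennreal (?P (Suc n) s t)"
      by (rule prod_Suc)
    finally show ?case .
  qed simp
  \<comment> \<open>\<open>measure_le\<close> asks for measures on both sides. The choice c = 1
    gives k_n itself, and n = 0 gives the multiples of k.\<close>
  have space_T: "measure_space (space M) (sets M) (\<lambda>A. ?T n s x t A * c)" if "x \<in> space M" for n s x t c
    using that
    by (intro measure_space_eqI[of "density (term_measure n s x t) (\<lambda>_. c)"])
      (simp_all add: emeasure_density_const emeasure_term_measure mult.commute)
  \<comment> \<open>Left open in the limit \<open>S\<close>, so that the binomial and the
    exponential case share it. The empty product at n = 0 accounts for k_0 = k.\<close>
  have sum_le: "measure_le M (series_sum M \<mu> J k s x t) (\<lambda>A. emeasure (k s x t) A * ennreal S)"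
    if x: "x \<in> space M" and S: "(\<lambda>n. ?P n s t) sums S" for s x t S
    unfolding measure_le_def
  proof (intro conjI ballI)
    show "measure_space (space M) (sets M) (series_sum M \<mu> J k s x t)"
      unfolding series_sum_def using space_T[OF x, where c = 1] by (intro measure_space_suminf) simp
    show "measure_space (space M) (sets M) (\<lambda>A. emeasure (k s x t) A * ennreal S)"
      using space_T[OF x, of 0] by simp
    fix A assume A: "A \<in> sets M"
    have "series_sum M \<mu> J k s x t A \<le> (\<Sum>n. emeasure (k s x t) A * ennreal (?P n s t))"
      unfolding series_sum_def by (intro suminf_le prod_bound[OF x A]) auto
    also have "\<dots> = emeasure (k s x t) A * ennreal S"
      using S factor_nonneg by (simp add: suminf_ennreal2 prod_nonneg sums_iff)
    finally show "series_sum M \<mu> J k s x t A \<le> emeasure (k s x t) A * ennreal S" .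
  qed
  have "measure_le M (?T n s x t) (\<lambda>A. ?T (n - 1) s x t A * ennreal (\<eta> + Q s t / real n)) \<and>
      measure_le M (\<lambda>A. ?T (n - 1) s x t A * ennreal (\<eta> + Q s t / real n))
        (\<lambda>A. emeasure (k s x t) A * ennreal (?P n s t))" if n: "n \<ge> 1" and x: "x \<in> space M" for n s x t
  proof -
    obtain j where j: "n = Suc j" using n by (cases n) auto
    have "?T j s x t A * ennreal (\<eta> + Q s t / real n) \<le> emeasure (k s x t) A * ennreal (?P n s t)"
      if "A \<in> sets M" for A
    proof -
      have "?T j s x t A * ennreal (\<eta> + Q s t / real n)
          \<le> emeasure (k s x t) A * ennreal (?P j s t) * ennreal (\<eta> + Q s t / real n)"
        by (rule mult_right_mono[OF prod_bound[OF x that]]) simp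
      also have "\<dots> = emeasure (k s x t) A * ennreal (?P n s t)"
        unfolding j by (rule prod_Suc)
      finally show ?thesis .
    qed
    then show ?thesis
      using step[OF x] space_T[OF x] space_T[OF x, of n s t 1] space_T[OF x, of 0]
      by (simp add: measure_le_def j)
  qed
  moreover have "(\<lambda>n. ?P n s t) sums exp (Q s t)" if "\<eta> = 0" for s t
    using that sums_prod_ratio[of "Q s t"] by simp
  ultimately show ?thesis
    using sum_le sums_prod_shifted_ratio by blast
qed

end
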